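(* Let $f:\Sigma\to\mathcal{Z}$ be an umbilic-free $\Omega$-surface such that its isothermic sphere congruence $\Lambda:=s^{+}$ is an isothermic surface in the conformal geometry $\langle\mathfrak{p}\rangle^{\perp}$, where $\mathfrak{p}\in\mathbb{R}^{4,2}$ is not lightlike and not zero. Then the Calapso transforms of $f$ are (up to Lie sphere transformations) the Legendre lifts of the Calapso transforms of the isothermic surface $\Lambda$.
   Context: $\mathbb{R}^{4,2}$ is a 6-dimensional real vector space with a non-degenerate symmetric bilinear form $(\,,\,)$ of signature $(4,2)$, $\mathcal{L}$ its lightcone; $\wedge^2\mathbb{R}^{4,2}\cong\mathfrak{o}(4,2)$ via $a\wedge b\,(c)=(a,c)b-(b,c)a$. Lie sphere transformations are induced by elements of $\mathrm{O}(4,2)$. $\Sigma$ is a smooth 2-manifold, $\underline{\mathbb{R}}^{4,2}=\Sigma\times\mathbb{R}^{4,2}$, $d$ its trivial connection; $W^{(1)}$ is spanned by sections of a subbundle $W$ and their derivatives. $\mathcal{Z}$ is the Grassmannian of isotropic 2-planes; a smooth $f:\Sigma\to\mathcal{Z}$ (a rank 2 subbundle) is a Legendre map if $f^{(1)}\le f^\perp$ and no non-zero $X\in T\Sigma$ satisfies $d_X\sigma\in f$ for all $\sigma\in\Gamma f$. Curvature spheres at $p$ are lines $s(p)\le f(p)$ killed by $\sigma\mapsto d_X\sigma\bmod f$ for all $X$ in some non-zero subspace of $T_p\Sigma$; $f$ is umbilic-free if there are exactly two at each point, forming rank 1 bundles $s_1,s_2$ with $f=s_1\oplus s_2$ and curvature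 subbundles $T_1,T_2$. A gauge potential is a closed $\eta\in\Omega^1(f\wedge f^\perp)$ with $[\eta\wedge\eta]=0$ such that $q(X,Y)=\mathrm{tr}(\sigma\mapsto\eta(X)d_Y\sigma:f\to f)$ is non-zero; $f$ is an $\Omega$-surface if $q$ is non-degenerate on a dense open set (the signature of $q$ is assumed constant). The gauge orbit is $\{\eta-d\tau:\tau\in\Gamma(\wedge^2f)\}$. For an umbilic-free $\Omega$-surface (after possibly replacing $\eta$ by $-\eta$ and swapping indices) there are lifts $\sigma_i\in\Gamma s_i$, unique up to sign, and $\epsilon\in\{1,i\}$ with $q=(d\sigma_1,d\sigma_1)-\epsilon^2(d\sigma_2,d\sigma_2)$. The isothermic sphere congruences are $s^\pm=\langle\sigma_1\pm\epsilon\sigma_2\rangle$; they have lifts $\sigma^\pm\in\Gamma s^\pm$ (Christoffel dual lifts) such that $\eta^\pm:=\sigma^\pm\wedge d\sigma^\mp$ lie in the gauge orbit. For $t\in\mathbb{R}$, let $T(t):\Sigma\to\mathrm{O}(4,2)$ be a local gauge transformation with $T(t)\cdot(d+t\eta)=d$ (here $g\cdot\nabla=g\circ\nabla\circ g^{-1}$); it is unique up to left multiplication by constants. $f^t=T(t)f$ is a Calapso transform of $f$; up to constant Lie sphere transformations it does not depend on the choice of $\eta$ in its gauge orbit. An isothermic surface in $\langle\mathfrak{p}\rangle^\perp$ is an immersion $\Lambda:\Sigma\to\mathbb{P}(\mathcal{L}\cap\langle\mathfrak{p}\rangle^\perp)$ admitting a non-zero closed $\eta\in\Omega^1(\Lambda\wedge\Lambda^{(1)})$;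 here $\eta=\eta^+$. Then $(d+t\eta^+)\mathfrak{p}=0$, and a Calapso transform of the isothermic surface $\Lambda$ is $T(t)\Lambda$, where $T(t)$ trivialises $d+t\eta^+$, normalised so that $T(t)\mathfrak{p}=\mathfrak{p}$ (so it restricts to an orthogonal trivialising gauge transformation of $\langle\mathfrak{p}\rangle^\perp$). A Legendre lift of a surface $\Lambda$ is a Legendre map containing $\Lambda$ as subbundle. *)

theory Defs
  imports "HOL-Analysis.Analysis"
begin

section \<open>Lie sphere geometry: the space of signature (4,2)\<close>

type_synonym r42 = "(real^4) \<times> (real^2)"

definition lform :: "r42 \<Rightarrow> r42 \<Rightarrow> real" where
  "lform x y = fst x \<bullet> fst y - snd x \<bullet> snd y"

definition lightcone :: "r42 set" where
  "lightcone = {v. lform v v = 0}"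

definition perp :: "r42 set \<Rightarrow> r42 set" where
  "perp W = {v. \<forall>w\<in>W. lform v w = 0}"

definition isotropic :: "r42 set \<Rightarrow> bool" where
  "isotropic W \<longleftrightarrow> (\<forall>v\<in>W. \<forall>w\<in>W. lform v w = 0)"

type_synonym endo42 = "r42 \<Rightarrow>\<^sub>L r42"

definition orthogonal42 :: "endo42 \<Rightarrow> bool" where
  "orthogonal42 g \<longleftrightarrow> (\<forall>x y. lform (blinfun_apply g x) (blinfun_apply g y) = lform x y)"

definition wedge :: "r42 \<Rightarrow> r42 \<Rightarrow> endo42" where
  "wedge a b = Blinfun (\<lambda>c. lform a c *\<^sub>R b - lform b c *\<^sub>R a)"

lemma wedge_apply: "blinfun_apply (wedge a b) c = lform a c *\<^sub>R b - lform b c *\<^sub>R a"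
proof -
  have "bounded_linear (\<lambda>c. lform a c *\<^sub>R b - lform b c *\<^sub>R a)"
    unfolding lform_def
    by (intro bounded_linear_intros bounded_linear_compose[OF bounded_linear_inner_right]
        bounded_linear_fst bounded_linear_snd)
  then show ?thesis
    unfolding wedge_def by (rule bounded_linear_Blinfun_apply[THEN fun_cong])
qed

definition wedge_space :: "r42 set \<Rightarrow> r42 set \<Rightarrow> endo42 set" where
  "wedge_space P Q = span {wedge a b | a b. a \<in> P \<and> b \<in> Q}"

text \<open>The complexification of a real vector space: the pair \<open>(u, v)\<close> stands for \<open>u + \<i>v\<close>.\<close>

definition cembed :: "'v::real_vector \<Rightarrow> 'v \<times> 'v" where
  "cembed u = (u, 0)"

definition cscale :: "complex \<Rightarrow> 'v::real_vector \<times> 'v \<Rightarrow> 'v \<times> 'v" where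
  "cscale c w = (Re c *\<^sub>R fst w - Im c *\<^sub>R snd w, Re c *\<^sub>R snd w + Im c *\<^sub>R fst w)"

definition complexify :: "'v::real_vector set \<Rightarrow> ('v \<times> 'v) set" where
  "complexify W = W \<times> W"

text \<open>Complex bilinear extension of \<open>wedge\<close>.\<close>

definition cwedge :: "r42 \<times> r42 \<Rightarrow> r42 \<times> r42 \<Rightarrow> endo42 \<times> endo42" where
  "cwedge x y = (wedge (fst x) (fst y) - wedge (snd x) (snd y),
                 wedge (fst x) (snd y) + wedge (snd x) (fst y))"


section \<open>Smooth surfaces\<close>

text \<open>To be used on open sets of a finite-dimensional space, where being \<open>C\<^sup>k\<close> amounts to
  differentiability with all directional derivatives \<open>C\<^bsup>k-1\<^esup>\<close>.\<close>

fun Ck_on :: "nat \<Rightarrow> ('b::real_normed_vector) set \<Rightarrow> ('b \<Rightarrow> 'c::real_normed_vector) \<Rightarrow> bool" where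
  "Ck_on 0 S h \<longleftrightarrow> continuous_on S h"
| "Ck_on (Suc k) S h \<longleftrightarrow> (\<forall>x\<in>S. h differentiable (at x)) \<and>
     (\<forall>v. Ck_on k S (\<lambda>x. frechet_derivative h (at x) v))"

definition smooth_on :: "('b::real_normed_vector) set \<Rightarrow> ('b \<Rightarrow> 'c::real_normed_vector) \<Rightarrow> bool" where
  "smooth_on S h \<longleftrightarrow> (\<forall>k. Ck_on k S h)"

text \<open>The surface is a Hausdorff, second countable type with an atlas (not necessarily maximal).
  A chart is its domain together with its coordinate map, whose values outside the domain are
  irrelevant.\<close>

type_synonym 'a chart = "'a set \<times> ('a \<Rightarrow> real^2)"

definition param :: "'a chart \<Rightarrow> real^2 \<Rightarrow> 'a" where
  "param c = inv_into (fst c) (snd c)"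

definition is_chart :: "('a::topological_space) chart \<Rightarrow> bool" where
  "is_chart c \<longleftrightarrow> open (fst c) \<and> open (snd c ` fst c) \<and>
     homeomorphism (fst c) (snd c ` fst c) (snd c) (param c)"

definition smooth_atlas :: "('a::{t2_space,second_countable_topology}) chart set \<Rightarrow> bool" where
  "smooth_atlas A \<longleftrightarrow> (\<forall>c\<in>A. is_chart c) \<and> (\<Union>c\<in>A. fst c) = UNIV \<and>
     (\<forall>c\<in>A. \<forall>c'\<in>A. smooth_on (snd c ` (fst c \<inter> fst c')) (snd c' \<circ> param c))"

definition smooth_map ::
  "('a::topological_space) chart set \<Rightarrow> 'a set \<Rightarrow> ('a \<Rightarrow> 'w::real_normed_vector) \<Rightarrow> bool" where
  "smooth_map A U h \<longleftrightarrow> (\<forall>c\<in>A. smooth_on (snd c ` (fst c \<inter> U)) (h \<circ> param c))"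

text \<open>The tangent space at \<open>p\<close> is identified with \<open>\<real>\<^sup>2\<close> by means of one chosen chart
  around \<open>p\<close>. So \<open>mderiv A h p X\<close> is \<open>d\<^sub>X h\<close> at \<open>p\<close>.\<close>

definition chart_at :: "'a chart set \<Rightarrow> 'a \<Rightarrow> 'a chart" where
  "chart_at A p = (SOME c. c \<in> A \<and> p \<in> fst c)"

definition mderiv :: "'a chart set \<Rightarrow> ('a \<Rightarrow> 'w::real_normed_vector) \<Rightarrow> 'a \<Rightarrow> real^2 \<Rightarrow> 'w" where
  "mderiv A h p X =
     frechet_derivative (h \<circ> param (chart_at A p)) (at (snd (chart_at A p) p)) X"

text \<open>Representation of a 1-form in a chart \<open>c\<close>: at the point \<open>x\<close> of the coordinate domain the
  vector \<open>v\<close> is converted to the chosen chart around \<open>param c x\<close>.\<close>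

definition form_in_chart ::
  "'a chart set \<Rightarrow> ('a \<Rightarrow> real^2 \<Rightarrow> 'w) \<Rightarrow> 'a chart \<Rightarrow> real^2 \<Rightarrow> real^2 \<Rightarrow> 'w" where
  "form_in_chart A \<theta> c x v =
     \<theta> (param c x) (frechet_derivative (snd (chart_at A (param c x)) \<circ> param c) (at x) v)"

definition one_form ::
  "'a chart set \<Rightarrow> ('a \<Rightarrow> real^2 \<Rightarrow> 'w::real_normed_vector) \<Rightarrow> bool" where
  "one_form A \<theta> \<longleftrightarrow> (\<forall>p. linear (\<theta> p)) \<and>
     (\<forall>c\<in>A. \<forall>v. smooth_on (snd c ` fst c) (\<lambda>x. form_in_chart A \<theta> c x v))"

definition ext_deriv ::
  "'a chart set \<Rightarrow> ('a \<Rightarrow> real^2 \<Rightarrow> 'w::real_normed_vector) \<Rightarrow> 'a \<Rightarrow> real^2 \<Rightarrow> real^2 \<Rightarrow> 'w" where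
  "ext_deriv A \<theta> p X Y = (let c = chart_at A p; x = snd c p in
     frechet_derivative (\<lambda>y. form_in_chart A \<theta> c y Y) (at x) X -
     frechet_derivative (\<lambda>y. form_in_chart A \<theta> c y X) (at x) Y)"

definition closed_form ::
  "'a chart set \<Rightarrow> ('a \<Rightarrow> real^2 \<Rightarrow> 'w::real_normed_vector) \<Rightarrow> bool" where
  "closed_form A \<theta> \<longleftrightarrow> one_form A \<theta> \<and> (\<forall>p X Y. ext_deriv A \<theta> p X Y = 0)"


section \<open>Subbundles of the trivial bundle\<close>

definition subbundle ::
  "('a::topological_space) chart set \<Rightarrow> 'a set \<Rightarrow> nat \<Rightarrow> ('a \<Rightarrow> 'v::euclidean_space set) \<Rightarrow> bool" where
  "subbundle A U r W \<longleftrightarrow>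
     (\<forall>p\<in>U. subspace (W p) \<and> dim (W p) = r) \<and>
     (\<forall>p\<in>U. \<exists>N e. open N \<and> p \<in> N \<and> N \<subseteq> U \<and> (\<forall>i<r. smooth_map A N (e i)) \<and>
        (\<forall>q\<in>N. W q = span {e i q | i. i < r}))"

definition section_on ::
  "('a::topological_space) chart set \<Rightarrow> 'a set \<Rightarrow> ('a \<Rightarrow> 'v::real_normed_vector set) \<Rightarrow>
     ('a \<Rightarrow> 'v) \<Rightarrow> bool" where
  "section_on A U W \<sigma> \<longleftrightarrow> smooth_map A U \<sigma> \<and> (\<forall>p\<in>U. \<sigma> p \<in> W p)"

definition lift_on ::
  "('a::topological_space) chart set \<Rightarrow> 'a set \<Rightarrow> ('a \<Rightarrow> 'v::real_normed_vector set) \<Rightarrow>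
     ('a \<Rightarrow> 'v) \<Rightarrow> bool" where
  "lift_on A U W \<sigma> \<longleftrightarrow> section_on A U W \<sigma> \<and> (\<forall>p\<in>U. \<sigma> p \<noteq> 0)"

text \<open>Conditions on all sections are imposed on all local sections around the point in
  question.\<close>

definition local_section ::
  "('a::topological_space) chart set \<Rightarrow> ('a \<Rightarrow> 'v::real_normed_vector set) \<Rightarrow> 'a \<Rightarrow>
     ('a \<Rightarrow> 'v) \<Rightarrow> bool" where
  "local_section A W p \<sigma> \<longleftrightarrow> (\<exists>N. open N \<and> p \<in> N \<and> section_on A N W \<sigma>)"

definition derived ::
  "('a::topological_space) chart set \<Rightarrow> ('a \<Rightarrow> 'v::real_normed_vector set) \<Rightarrow> 'a \<Rightarrow> 'v set" where
  "derived A W p = span ({\<sigma> p | \<sigma>. local_section A W p \<sigma>} \<union>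
                         {mderiv A \<sigma> p X | \<sigma> X. local_section A W p \<sigma>})"

text \<open>For a subbundle \<open>W\<close>, seen as a map into a Grassmannian, this says that its differential
  \<open>X \<mapsto> (\<sigma> \<mapsto> d\<^sub>X \<sigma> mod W)\<close> is injective.\<close>

definition immersed ::
  "('a::topological_space) chart set \<Rightarrow> 'a set \<Rightarrow> ('a \<Rightarrow> 'v::real_normed_vector set) \<Rightarrow> bool" where
  "immersed A U W \<longleftrightarrow>
     (\<forall>p\<in>U. \<forall>X. (\<forall>\<sigma>. local_section A W p \<sigma> \<longrightarrow> mderiv A \<sigma> p X \<in> W p) \<longrightarrow> X = 0)"


section \<open>Legendre maps and curvature spheres\<close>

definition legendre_map ::
  "('a::topological_space) chart set \<Rightarrow> 'a set \<Rightarrow> ('a \<Rightarrow> r42 set) \<Rightarrow> bool" where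
  "legendre_map A U f \<longleftrightarrow> subbundle A U 2 f \<and> (\<forall>p\<in>U. isotropic (f p)) \<and>
     (\<forall>p\<in>U. derived A f p \<subseteq> perp (f p)) \<and> immersed A U f"

definition curvature_sphere ::
  "('a::topological_space) chart set \<Rightarrow> ('a \<Rightarrow> r42 set) \<Rightarrow> 'a \<Rightarrow> r42 set \<Rightarrow> bool" where
  "curvature_sphere A f p l \<longleftrightarrow> subspace l \<and> dim l = 1 \<and> l \<subseteq> f p \<and>
     (\<exists>K. subspace K \<and> K \<noteq> {0} \<and>
        (\<forall>X\<in>K. \<forall>\<sigma>. local_section A f p \<sigma> \<and> \<sigma> p \<in> l \<longrightarrow> mderiv A \<sigma> p X \<in> f p))"

text \<open>\<open>f\<close> is umbilic-free with curvature sphere congruences \<open>s1\<close> and \<open>s2\<close>. Two different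
  lines in the plane \<open>f p\<close> are complementary in it.\<close>

definition umbilic_free ::
  "('a::topological_space) chart set \<Rightarrow> ('a \<Rightarrow> r42 set) \<Rightarrow> ('a \<Rightarrow> r42 set) \<Rightarrow>
     ('a \<Rightarrow> r42 set) \<Rightarrow> bool" where
  "umbilic_free A f s1 s2 \<longleftrightarrow> subbundle A UNIV 1 s1 \<and> subbundle A UNIV 1 s2 \<and>
     (\<forall>p. s1 p \<noteq> s2 p \<and> {l. curvature_sphere A f p l} = {s1 p, s2 p})"


section \<open>Omega surfaces\<close>

text \<open>Trace of a linear endomorphism \<open>L\<close> of the subspace \<open>W\<close>, with respect to any basis.\<close>

definition trace_on :: "'v::euclidean_space set \<Rightarrow> ('v \<Rightarrow> 'v) \<Rightarrow> real" where
  "trace_on W L = (let B = (SOME B. B \<subseteq> W \<and> independent B \<and> span B = W) in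
     \<Sum>b\<in>B. representation B (L b) b)"

text \<open>For \<open>\<eta>\<close> with values in \<open>f \<and> f\<^sup>\<bottom>\<close> and a Legendre map \<open>f\<close>, the endomorphism
  \<open>\<sigma> \<mapsto> \<eta>(X) d\<^sub>Y \<sigma>\<close> is tensorial: its value on \<open>a \<in> f p\<close> can be computed with any local
  section through \<open>a\<close>.\<close>

definition qdiff ::
  "('a::topological_space) chart set \<Rightarrow> ('a \<Rightarrow> r42 set) \<Rightarrow> ('a \<Rightarrow> real^2 \<Rightarrow> endo42) \<Rightarrow>
     'a \<Rightarrow> real^2 \<Rightarrow> real^2 \<Rightarrow> real" where
  "qdiff A f \<eta> p X Y = trace_on (f p)
     (\<lambda>a. blinfun_apply (\<eta> p X) (mderiv A (SOME \<sigma>. local_section A f p \<sigma> \<and> \<sigma> p = a) p Y))"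

definition bracket :: "endo42 \<Rightarrow> endo42 \<Rightarrow> endo42" where
  "bracket S T = (S o\<^sub>L T) - (T o\<^sub>L S)"

definition gauge_potential ::
  "('a::topological_space) chart set \<Rightarrow> ('a \<Rightarrow> r42 set) \<Rightarrow> ('a \<Rightarrow> real^2 \<Rightarrow> endo42) \<Rightarrow> bool" where
  "gauge_potential A f \<eta> \<longleftrightarrow> closed_form A \<eta> \<and>
     (\<forall>p X. \<eta> p X \<in> wedge_space (f p) (perp (f p))) \<and>
     (\<forall>p X Y. bracket (\<eta> p X) (\<eta> p Y) - bracket (\<eta> p Y) (\<eta> p X) = 0) \<and>
     (\<exists>p X Y. qdiff A f \<eta> p X Y \<noteq> 0)"

text \<open>Numbers of positive and of negative directions of a symmetric bilinear form.\<close>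

definition signature :: "(real^2 \<Rightarrow> real^2 \<Rightarrow> real) \<Rightarrow> nat \<times> nat" where
  "signature b =
     (Max {dim K | K. subspace K \<and> (\<forall>X\<in>K. X \<noteq> 0 \<longrightarrow> b X X > 0)},
      Max {dim K | K. subspace K \<and> (\<forall>X\<in>K. X \<noteq> 0 \<longrightarrow> b X X < 0)})"

definition omega_surface ::
  "('a::topological_space) chart set \<Rightarrow> ('a \<Rightarrow> r42 set) \<Rightarrow> ('a \<Rightarrow> real^2 \<Rightarrow> endo42) \<Rightarrow> bool" where
  "omega_surface A f \<eta> \<longleftrightarrow> legendre_map A UNIV f \<and> gauge_potential A f \<eta> \<and>
     (\<exists>D. open D \<and> closure D = UNIV \<and>
        (\<forall>p\<in>D. \<forall>X. (\<forall>Y. qdiff A f \<eta> p X Y = 0) \<longrightarrow> X = 0)) \<and>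
     (\<forall>p p'. signature (qdiff A f \<eta> p) = signature (qdiff A f \<eta> p'))"

definition normalised_lifts ::
  "('a::topological_space) chart set \<Rightarrow> ('a \<Rightarrow> r42 set) \<Rightarrow> ('a \<Rightarrow> real^2 \<Rightarrow> endo42) \<Rightarrow>
     ('a \<Rightarrow> r42 set) \<Rightarrow> ('a \<Rightarrow> r42 set) \<Rightarrow> ('a \<Rightarrow> r42) \<Rightarrow> ('a \<Rightarrow> r42) \<Rightarrow> complex \<Rightarrow> bool" where
  "normalised_lifts A f \<eta> s1 s2 \<sigma>1 \<sigma>2 \<epsilon> \<longleftrightarrow>
     lift_on A UNIV s1 \<sigma>1 \<and> lift_on A UNIV s2 \<sigma>2 \<and> \<epsilon> \<in> {1, \<i>} \<and>
     (\<forall>p X Y. complex_of_real (qdiff A f \<eta> p X Y) =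
        complex_of_real (lform (mderiv A \<sigma>1 p X) (mderiv A \<sigma>1 p Y)) -
        \<epsilon>\<^sup>2 * complex_of_real (lform (mderiv A \<sigma>2 p X) (mderiv A \<sigma>2 p Y)))"

text \<open>The isothermic sphere congruences, as complex lines in the complexification of \<open>f\<close>, are
  \<open>isothermic_sphere \<epsilon> \<sigma>1 \<sigma>2\<close> and \<open>isothermic_sphere (- \<epsilon>) \<sigma>1 \<sigma>2\<close>.\<close>

definition isothermic_sphere ::
  "complex \<Rightarrow> ('a \<Rightarrow> r42) \<Rightarrow> ('a \<Rightarrow> r42) \<Rightarrow> 'a \<Rightarrow> (r42 \<times> r42) set" where
  "isothermic_sphere \<epsilon> \<sigma>1 \<sigma>2 p =
     range (\<lambda>c. cscale c (cembed (\<sigma>1 p) + cscale \<epsilon> (cembed (\<sigma>2 p))))"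

text \<open>The gauge orbit of \<open>\<eta>\<close>, complexified because the lifts of the isothermic sphere
  congruences need not be real.\<close>

definition in_gauge_orbit ::
  "('a::topological_space) chart set \<Rightarrow> ('a \<Rightarrow> r42 set) \<Rightarrow> ('a \<Rightarrow> real^2 \<Rightarrow> endo42) \<Rightarrow>
     ('a \<Rightarrow> real^2 \<Rightarrow> endo42 \<times> endo42) \<Rightarrow> bool" where
  "in_gauge_orbit A f \<eta> \<theta> \<longleftrightarrow>
     (\<exists>\<tau>. section_on A UNIV (\<lambda>p. complexify (wedge_space (f p) (f p))) \<tau> \<and>
        (\<forall>p X. \<theta> p X = cembed (\<eta> p X) - mderiv A \<tau> p X))"

definition christoffel_dual_lifts ::
  "('a::topological_space) chart set \<Rightarrow> ('a \<Rightarrow> r42 set) \<Rightarrow> ('a \<Rightarrow> real^2 \<Rightarrow> endo42) \<Rightarrow>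
     ('a \<Rightarrow> (r42 \<times> r42) set) \<Rightarrow> ('a \<Rightarrow> (r42 \<times> r42) set) \<Rightarrow>
     ('a \<Rightarrow> r42 \<times> r42) \<Rightarrow> ('a \<Rightarrow> r42 \<times> r42) \<Rightarrow> bool" where
  "christoffel_dual_lifts A f \<eta> sp sm \<sigma>p \<sigma>m \<longleftrightarrow>
     lift_on A UNIV sp \<sigma>p \<and> lift_on A UNIV sm \<sigma>m \<and>
     in_gauge_orbit A f \<eta> (\<lambda>p X. cwedge (\<sigma>p p) (mderiv A \<sigma>m p X)) \<and>
     in_gauge_orbit A f \<eta> (\<lambda>p X. cwedge (\<sigma>m p) (mderiv A \<sigma>p p X))"


section \<open>Calapso transforms and isothermic surfaces\<close>

text \<open>Connections on the trivial bundle as operators on sections.\<close>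

type_synonym 'a connection = "('a \<Rightarrow> r42) \<Rightarrow> 'a \<Rightarrow> real^2 \<Rightarrow> r42"

definition pencil ::
  "'a chart set \<Rightarrow> ('a \<Rightarrow> real^2 \<Rightarrow> endo42) \<Rightarrow> real \<Rightarrow> 'a connection" where
  "pencil A \<eta> t \<psi> p X = mderiv A \<psi> p X + t *\<^sub>R blinfun_apply (\<eta> p X) (\<psi> p)"

definition gauge_action :: "('a \<Rightarrow> endo42) \<Rightarrow> 'a connection \<Rightarrow> 'a connection" where
  "gauge_action T D \<psi> p X =
     blinfun_apply (T p) (D (\<lambda>r. inv (blinfun_apply (T r)) (\<psi> r)) p X)"

definition trivialising_gauge ::
  "('a::topological_space) chart set \<Rightarrow> 'a set \<Rightarrow> ('a \<Rightarrow> real^2 \<Rightarrow> endo42) \<Rightarrow> real \<Rightarrow>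
     ('a \<Rightarrow> endo42) \<Rightarrow> bool" where
  "trivialising_gauge A U \<eta> t T \<longleftrightarrow> smooth_map A U T \<and> (\<forall>p\<in>U. orthogonal42 (T p)) \<and>
     (\<forall>\<psi>. smooth_map A U \<psi> \<longrightarrow>
        (\<forall>p\<in>U. \<forall>X. gauge_action T (pencil A \<eta> t) \<psi> p X = mderiv A \<psi> p X))"

definition calapso_transform ::
  "('a::topological_space) chart set \<Rightarrow> 'a set \<Rightarrow> ('a \<Rightarrow> r42 set) \<Rightarrow>
     ('a \<Rightarrow> real^2 \<Rightarrow> endo42) \<Rightarrow> real \<Rightarrow> ('a \<Rightarrow> r42 set) \<Rightarrow> bool" where
  "calapso_transform A U f \<eta> t F \<longleftrightarrow>
     (\<exists>T. trivialising_gauge A U \<eta> t T \<and> (\<forall>p\<in>U. F p = blinfun_apply (T p) ` f p))"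

text \<open>\<open>\<Lambda>\<close> is an isothermic surface in the conformal geometry of \<open>perp {k}\<close>, with closed
  1-form \<open>\<eta>\<close>.\<close>

definition isothermic_surface ::
  "('a::topological_space) chart set \<Rightarrow> r42 \<Rightarrow> ('a \<Rightarrow> r42 set) \<Rightarrow>
     ('a \<Rightarrow> real^2 \<Rightarrow> endo42) \<Rightarrow> bool" where
  "isothermic_surface A k \<Lambda> \<eta> \<longleftrightarrow>
     subbundle A UNIV 1 \<Lambda> \<and> (\<forall>p. \<Lambda> p \<subseteq> lightcone \<inter> perp {k}) \<and> immersed A UNIV \<Lambda> \<and>
     closed_form A \<eta> \<and> (\<exists>p X. \<eta> p X \<noteq> 0) \<and>
     (\<forall>p X. \<eta> p X \<in> wedge_space (\<Lambda> p) (derived A \<Lambda> p))"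

definition isothermic_calapso_transform ::
  "('a::topological_space) chart set \<Rightarrow> 'a set \<Rightarrow> r42 \<Rightarrow> ('a \<Rightarrow> r42 set) \<Rightarrow>
     ('a \<Rightarrow> real^2 \<Rightarrow> endo42) \<Rightarrow> real \<Rightarrow> ('a \<Rightarrow> r42 set) \<Rightarrow> bool" where
  "isothermic_calapso_transform A U k \<Lambda> \<eta> t L \<longleftrightarrow>
     (\<exists>T. trivialising_gauge A U \<eta> t T \<and> (\<forall>p\<in>U. blinfun_apply (T p) k = k) \<and>
        (\<forall>p\<in>U. L p = blinfun_apply (T p) ` \<Lambda> p))"

definition legendre_lift ::
  "('a::topological_space) chart set \<Rightarrow> 'a set \<Rightarrow> ('a \<Rightarrow> r42 set) \<Rightarrow> ('a \<Rightarrow> r42 set) \<Rightarrow> bool" where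
  "legendre_lift A U L F \<longleftrightarrow> legendre_map A U F \<and> (\<forall>p\<in>U. L p \<subseteq> F p)"

end

theory Submission
  imports Defs
begin

text \<open>
  Gauge transformations carry the potential \<open>\<eta>\<close> of \<open>f\<close> to that of the isothermic surface
  without moving \<open>f\<close>. The Christoffel dual lifts give \<open>\<eta>\<^sup>+ = \<eta> - d\<tau>\<close> with \<open>\<tau>\<close> in
  \<open>f \<and> f\<close>, and \<open>exp (- t\<tau>) = 1 - t\<tau>\<close> restricts to the identity on \<open>f\<close>. If \<open>T\<close>
  trivialises \<open>d + t\<eta>\<close>, then \<open>T (1 - t\<tau>)\<close> trivialises \<open>d + t\<eta>\<^sup>+\<close> and maps \<open>f\<close> to the
  same Calapso transform (\<open>trivialising_gauge_orbit\<close>, \<open>gauge_orbit_image\<close>).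

  Since \<open>\<eta>\<close> kills \<open>f\<close>, one has \<open>d (T\<sigma>) = T d\<sigma>\<close> for sections of \<open>f\<close>. Therefore \<open>T f\<close> is
  again a Legendre map (\<open>legendre_map_gauge\<close>), and it contains \<open>T (1 - t\<tau>) \<Lambda>\<close>. As \<open>\<eta>\<^sup>+\<close> kills
  \<open>k\<close>, the vector \<open>T (1 - t\<tau>) k\<close> is constant on a connected set, and an orthogonal
  map brings it back to \<open>k\<close> (\<open>ex_orthogonal_map_vector\<close>). This shows that Calapso transforms
  of \<open>f\<close> are Legendre lifts of Calapso transforms of \<open>\<Lambda>\<close>.

  Conversely a Legendre lift of \<open>T \<Lambda>\<close> has to be compared with the lift \<open>T f\<close>. As \<open>\<Lambda>\<close> is
  real, it is spanned by \<open>s = \<sigma>1 + \<sigma>2\<close>, which is not a curvature sphere, so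
  \<open>X \<mapsto> d\<^sub>X s\<close> is injective modulo \<open>f\<close>. The form on \<open>f\<^sup>\<bottom> / f\<close> is positive definite, hence
  the tangent plane of \<open>\<Lambda>\<close> is spacelike and its normal bundle, which contains \<open>k\<close>, has
  signature (1,1). A Legendre lift chooses one of its two lightlike lines, and the reflection in
  \<open>k\<close> exchanges them (\<open>isotropic_planes_over_surface_element\<close>). By connectedness the choice is
  the same everywhere (\<open>legendre_lifts_of_surface\<close>), so any Legendre lift is \<open>T f\<close> up to
  that reflection.
\<close>

\<comment> \<open>Points of \<open>r42\<close> are handled as vectors, not as pairs of coordinates.\<close>
declare split_paired_All [simp del] split_paired_Ex [simp del]

section \<open>Algebra of the form of signature (4,2)\<close>

definition timeflip :: "r42 \<Rightarrow> r42" where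
  "timeflip v = (fst v, - snd v)"

lemma lform_eq_inner: "lform x y = x \<bullet> timeflip y" "lform x y = timeflip x \<bullet> y"
  by (simp_all add: lform_def timeflip_def inner_prod_def)

lemma bounded_bilinear_lform: "bounded_bilinear lform"
proof -
  have "bounded_linear timeflip"
    unfolding timeflip_def
    by (intro bounded_linear_Pair bounded_linear_minus bounded_linear_fst bounded_linear_snd)
  then have "bounded_bilinear (\<lambda>x y. x \<bullet> timeflip y)"
    by (rule bounded_bilinear.comp[OF bounded_bilinear_inner bounded_linear_ident])
  then show ?thesis by (simp add: lform_eq_inner(1)[abs_def])
qed

interpretation lform: bounded_bilinear lform
  by (rule bounded_bilinear_lform)

lemma lform_commute: "lform x y = lform y x"
  by (simp add: lform_def inner_commute)

lemma timeflip_timeflip [simp]: "timeflip (timeflip v) = v"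
  by (simp add: timeflip_def)

lemma linear_timeflip: "linear timeflip"
  by (rule linearI) (auto simp: timeflip_def)

lemma lform_nondegenerate:
  assumes "\<And>w. lform v w = 0" shows "v = 0"
proof -
  have "lform v (timeflip v) = v \<bullet> v" by (simp add: lform_eq_inner)
  then show ?thesis using assms by simp
qed

lemma subspace_perp: "subspace (perp W)"
  by (rule subspaceI) (auto simp: perp_def lform.zero_left lform.add_left lform.scaleR_left)

lemma isotropic_subset_perp: "isotropic W \<Longrightarrow> W \<subseteq> perp W"
  by (auto simp: isotropic_def perp_def)

lemma dim_nonpositive:
  assumes "\<And>v. v \<in> span W \<Longrightarrow> lform v v \<le> 0"
  shows "dim W \<le> 2"
proof -
  have "inj_on snd (span W)"
  proof (rule inj_onI)
    fix x y assume xy: "x \<in> span W" "y \<in> span W" "snd x = (snd y :: real^2)"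
    then have "x - y \<in> span W" "snd (x - y) = 0" by (simp_all add: span_diff)
    then have "fst (x - y) \<bullet> fst (x - y) \<le> 0" using assms[of "x - y"] by (simp add: lform_def)
    then have "fst (x - y) = 0" by (meson inner_gt_zero_iff linorder_not_less)
    then show "x = y" using xy(3) by (simp add: prod_eq_iff)
  qed
  then have "dim (snd ` W) = dim W"
    by (rule dim_image_eq[OF linear_snd])
  then show ?thesis using dim_subset_UNIV[of "snd ` W"] by simp
qed

definition isotropic_plane :: "r42 set \<Rightarrow> bool" where
  "isotropic_plane F \<longleftrightarrow> subspace F \<and> dim F = 2 \<and> isotropic F"

text \<open>The form induced on \<open>F\<^sup>\<bottom> / F\<close> is positive definite, because an isotropic plane
  already uses up both negative directions of the signature.\<close>

lemma mem_isotropic_plane: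
  assumes F: "isotropic_plane F" and v: "v \<in> perp F" and le: "lform v v \<le> 0"
  shows "v \<in> F"
proof -
  have sF: "subspace F" and dF: "dim F = 2" and iF: "isotropic F"
    using F by (auto simp: isotropic_plane_def)
  have "lform w w \<le> 0" if w: "w \<in> span (insert v F)" for w
  proof -
    obtain c where "w - c *\<^sub>R v \<in> span F" using w unfolding span_insert by blast
    moreover have "span F = F" using sF by (simp add: span_eq_iff)
    ultimately obtain u where u: "u \<in> F" "w = u + c *\<^sub>R v"
      by (metis diff_add_cancel)
    have "lform u u = 0" "lform v u = 0" using iF v u by (auto simp: isotropic_def perp_def)
    then have "lform w w = c\<^sup>2 * lform v v"
      by (simp add: u lform_commute[of u v] lform.add_left lform.add_right lform.scaleR_left
          lform.scaleR_right power2_eq_square)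
    then show ?thesis using le by (simp add: mult_nonneg_nonpos)
  qed
  then have "dim (insert v F) \<le> 2" by (rule dim_nonpositive)
  then have "dim (span (insert v F)) \<le> dim F" using dF by simp
  then have "F = span (insert v F)"
    using sF by (intro subspace_dim_equal) (auto intro: span_base)
  then show ?thesis by (metis insertI1 span_base)
qed

lemma isotropic_planes_eq_iff:
  assumes "isotropic_plane F" "isotropic_plane G"
  shows "G \<subseteq> perp F \<longleftrightarrow> G = F"
proof
  assume *: "G \<subseteq> perp F"
  have "lform v v = 0" if "v \<in> G" for v
    using that assms(2) by (simp add: isotropic_plane_def isotropic_def)
  then have "G \<subseteq> F" using mem_isotropic_plane[OF assms(1)] * by fastforce
  then show "G = F" using assms by (intro subspace_dim_equal) (auto simp: isotropic_plane_def)
next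
  assume "G = F"
  then show "G \<subseteq> perp F" using assms isotropic_subset_perp by (simp add: isotropic_plane_def)
qed

lemma dim_perp_isotropic_plane:
  assumes "isotropic_plane F" shows "dim (perp F) = 4"
proof -
  have sF: "subspace F" and dF: "dim F = 2" using assms by (auto simp: isotropic_plane_def)
  have inj: "inj timeflip" by (metis injI timeflip_timeflip)
  have e: "perp F = {y \<in> UNIV. \<forall>x \<in> timeflip ` F. orthogonal x y}"
    by (auto simp: perp_def orthogonal_def lform_eq_inner(1) inner_commute)
  have "dim (timeflip ` F) = 2"
    using dim_image_eq[OF linear_timeflip, of F] inj dF by (metis inj_on_subset subset_UNIV)
  then show ?thesis
    using dim_subspace_orthogonal_to_vectors[of "timeflip ` F" UNIV] sF
    by (simp add: e linear_subspace_image[OF linear_timeflip])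
qed

text \<open>By dimension, a plane \<open>range D \<le> F\<^sup>\<bottom>\<close> transverse to \<open>F\<close> represents all of
  \<open>F\<^sup>\<bottom> / F\<close>, on which the form is definite.\<close>

lemma mem_isotropic_plane_of_transverse:
  fixes D :: "real^2 \<Rightarrow> r42"
  assumes F: "isotropic_plane F" and D: "linear D" and DF: "\<And>X. D X \<in> perp F"
    and inj: "\<And>X. D X \<in> F \<Longrightarrow> X = 0"
    and u: "u \<in> perp F" and uD: "\<And>X. lform u (D X) = 0"
  shows "u \<in> F"
proof -
  have sF: "subspace F" and dF: "dim F = 2" and iF: "isotropic F"
    using F by (auto simp: isotropic_plane_def)
  have 0: "0 \<in> F" using sF by (rule subspace_0)
  have sR: "subspace (range D)" using linear_subspace_image[OF D subspace_UNIV] .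
  have "inj D" unfolding linear_injective_0[OF D] using inj 0 by auto
  then have dR: "dim (range D) = 2"
    using dim_image_eq[OF D, of UNIV] by (simp add: inj_on_subset)
  have "F \<inter> range D = {0}" using inj 0 linear_0[OF D] by fastforce
  then have "dim {x + y |x y. x \<in> F \<and> y \<in> range D} = 4"
    using dim_sums_Int[OF sF sR] dF dR by simp
  then have "{x + y |x y. x \<in> F \<and> y \<in> range D} = perp F" (is "?S = _")
    using DF isotropic_subset_perp[OF iF] dim_perp_isotropic_plane[OF F]
    by (intro subspace_dim_equal subspace_sums sF sR subspace_perp)
      (auto intro!: subspace_add[OF subspace_perp])
  then have "u \<in> ?S" using u by simp
  then obtain a X where a: "a \<in> F" "u = a + D X" by blast
  have "lform a (D X) = 0" using DF[of X] a(1) by (simp add: perp_def lform_commute[of a])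
  then have "lform (D X) (D X) = 0" using uD[of X] by (simp add: a lform.add_left)
  then have "X = 0" using mem_isotropic_plane[OF F DF] inj by auto
  then show ?thesis using a linear_0[OF D] by simp
qed

section \<open>Orthogonal maps\<close>

lemma orthogonal_compose:
  "orthogonal42 g \<Longrightarrow> orthogonal42 h \<Longrightarrow> orthogonal42 (g o\<^sub>L h)"
  by (simp add: orthogonal42_def)

lemma orthogonal_id: "orthogonal42 id_blinfun"
  by (simp add: orthogonal42_def)

lemma inj_orthogonal:
  assumes "orthogonal42 g" shows "inj (blinfun_apply g)"
proof (rule injI)
  fix x y assume xy: "g x = g y"
  have "lform (x - y) w = lform (g x) (g w) - lform (g y) (g w)" for w
    using assms by (simp add: orthogonal42_def lform.diff_left)
  then have "lform (x - y) w = 0" for w using xy by simp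
  then show "x = y" using lform_nondegenerate[of "x - y"] by simp
qed

lemma bij_orthogonal:
  assumes "orthogonal42 g" shows "bij (blinfun_apply g)"
  using inj_orthogonal[OF assms] linear_injective_imp_surjective[of g]
  by (simp add: bij_def blinfun.bounded_linear_right bounded_linear.linear)

text \<open>The inverse is the adjoint, hence linear in \<open>g\<close>. That makes it depend smoothly on a
  smooth gauge transformation.\<close>

lemma inv_orthogonal:
  assumes "orthogonal42 g"
  shows "inv (blinfun_apply g) w = (\<Sum>b\<in>Basis. lform (g b) w *\<^sub>R timeflip b)"
proof -
  define u where "u = inv (blinfun_apply g) w"
  have w: "w = g u" using bij_orthogonal[OF assms] by (simp add: u_def bij_def surj_f_inv_f)
  have "timeflip (timeflip u) = timeflip (\<Sum>b\<in>Basis. (timeflip u \<bullet> b) *\<^sub>R b)"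
    by (simp only: euclidean_representation)
  also have "\<dots> = (\<Sum>b\<in>Basis. lform b u *\<^sub>R timeflip b)"
    by (simp add: linear_sum[OF linear_timeflip] linear_scale[OF linear_timeflip]
        lform_eq_inner(1) inner_commute)
  finally have "u = (\<Sum>b\<in>Basis. lform (g b) w *\<^sub>R timeflip b)"
    unfolding w using assms by (simp only: orthogonal42_def timeflip_timeflip)
  then show ?thesis by (simp add: u_def)
qed

lemma orthogonal_image_isotropic:
  "orthogonal42 g \<Longrightarrow> isotropic W \<Longrightarrow> isotropic (blinfun_apply g ` W)"
  by (auto simp: orthogonal42_def isotropic_def)

lemma orthogonal_image_perp:
  "orthogonal42 g \<Longrightarrow> v \<in> perp W \<Longrightarrow> g v \<in> perp (blinfun_apply g ` W)"
  by (simp add: orthogonal42_def perp_def)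

lemma subspace_image_blinfun: "subspace W \<Longrightarrow> subspace (blinfun_apply g ` W)"
  by (simp add: linear_subspace_image blinfun.bounded_linear_right bounded_linear.linear)

lemma dim_orthogonal_image: "orthogonal42 g \<Longrightarrow> dim (blinfun_apply g ` W) = dim W"
  by (intro dim_image_eq inj_on_subset[OF inj_orthogonal])
    (auto simp: blinfun.bounded_linear_right bounded_linear.linear)

lemma isotropic_plane_image:
  "orthogonal42 g \<Longrightarrow> isotropic_plane F \<Longrightarrow> isotropic_plane (blinfun_apply g ` F)"
  by (simp add: isotropic_plane_def subspace_image_blinfun dim_orthogonal_image
      orthogonal_image_isotropic)

definition reflection :: "r42 \<Rightarrow> endo42" where
  "reflection k = Blinfun (\<lambda>v. v - (2 * lform v k / lform k k) *\<^sub>R k)"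

lemma reflection_apply: "reflection k v = v - (2 * lform v k / lform k k) *\<^sub>R k"
proof -
  have "bounded_linear (\<lambda>v. v - (lform v k * (2 / lform k k)) *\<^sub>R k)"
    by (intro bounded_linear_sub bounded_linear_ident
        bounded_linear_compose[OF bounded_linear_scaleR_left]
        bounded_linear_compose[OF bounded_linear_mult_left] lform.bounded_linear_left)
  then have "bounded_linear (\<lambda>v. v - (2 * lform v k / lform k k) *\<^sub>R k)"
    by (simp add: mult.commute)
  then show ?thesis unfolding reflection_def by (simp add: bounded_linear_Blinfun_apply)
qed

lemma orthogonal_reflection:
  assumes "lform k k \<noteq> 0" shows "orthogonal42 (reflection k)"
  unfolding orthogonal42_def
proof (intro allI)
  fix x y
  show "lform (reflection k x) (reflection k y) = lform x y"
    using assms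
    by (simp add: reflection_apply lform.diff_left lform.diff_right lform.scaleR_left
        lform.scaleR_right lform_commute[of k y] field_simps)
qed

lemma reflection_fixes: "lform v k = 0 \<Longrightarrow> reflection k v = v"
  by (simp add: reflection_apply)

text \<open>Witt's theorem for a line: by the parallelogram law one of \<open>k - k'\<close> and \<open>k + k'\<close> is
  not lightlike, and the reflection in it takes \<open>k'\<close> to \<open>\<plusminus>k\<close>.\<close>

lemma ex_orthogonal_map_vector:
  assumes nz: "lform k k \<noteq> 0" and eq: "lform k' k' = lform k k"
  shows "\<exists>g. orthogonal42 g \<and> g k' = k"
proof (cases "lform (k' - k) (k' - k) = 0")
  case False
  have "lform (k' - k) (k' - k) = 2 * lform k' (k' - k)"
    using eq by (simp add: lform.diff_left lform.diff_right lform_commute[of k k'])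
  then have "2 * lform k' (k' - k) / lform (k' - k) (k' - k) = 1" using False by simp
  then have "reflection (k' - k) k' = k" by (simp add: reflection_apply)
  then show ?thesis using orthogonal_reflection[OF False] by blast
next
  case True
  have p: "lform (k' + k) (k' + k) = 2 * lform k' (k' + k)"
    using eq by (simp add: lform.add_left lform.add_right lform_commute[of k k'])
  have "lform (k' + k) (k' + k) + lform (k' - k) (k' - k) = 4 * lform k k"
    using eq by (simp add: lform.add_left lform.add_right lform.diff_left lform.diff_right)
  then have nz': "lform (k' + k) (k' + k) \<noteq> 0" using True nz by simp
  then have "2 * lform k' (k' + k) / lform (k' + k) (k' + k) = 1" using p by simp
  then have "(- reflection (k' + k)) k' = k"
    by (simp add: reflection_apply blinfun.minus_left)
  moreover have "orthogonal42 (- reflection (k' + k))"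
    using orthogonal_reflection[OF nz']
    by (simp add: orthogonal42_def blinfun.minus_left lform.minus_left lform.minus_right)
  ultimately show ?thesis by blast
qed

section \<open>The two isotropic planes over a spacelike surface element\<close>

lemma span_pair_eq_plane:
  fixes F :: "'v::euclidean_space set"
  assumes "subspace F" "dim F = 2" "a \<in> F" "a \<noteq> 0" "b \<in> F" "b \<notin> span {a}"
  shows "span {a, b} = F"
proof (rule subspace_dim_equal)
  show "span {a, b} \<subseteq> F" using assms(1,3,5) by (intro span_minimal) auto
  have "independent {b, a}"
    using assms(4,6) by (intro independent_insertI) (auto simp: independent_empty)
  moreover have "b \<noteq> a" using assms(6) span_base[of a "{a}"] by blast
  ultimately have "dim {b, a} = 2" by (simp add: dim_eq_card_independent)
  then show "dim F \<le> dim (span {a, b})"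
    using assms(2) by (simp add: insert_commute[of a b])
qed (use assms(1) in auto)

lemma ex_plane_basis:
  fixes F :: "'v::euclidean_space set"
  assumes "subspace F" "dim F = 2" "a \<in> F" "a \<noteq> 0"
  obtains b where "b \<in> F" "span {a, b} = F"
proof -
  have "\<not> F \<subseteq> span {a}"
  proof
    assume "F \<subseteq> span {a}"
    then have "dim F \<le> dim {a}" by (metis dim_span dim_subset)
    also have "\<dots> \<le> 1" using dim_le_card'[of "{a}"] by simp
    finally show False using assms by simp
  qed
  then show ?thesis using that span_pair_eq_plane[OF assms] by blast
qed

text \<open>A vector orthogonal to \<open>F\<close> and to \<open>D\<close> would lie in \<open>F\<close> and be lightlike.\<close>

lemma transverse_plane_not_orthogonal:
  fixes D :: "real^2 \<Rightarrow> r42"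
  assumes "isotropic_plane F" "linear D" "\<And>X. D X \<in> perp F" "\<And>X. D X \<in> F \<Longrightarrow> X = 0"
    and k: "lform k k \<noteq> 0" "\<And>X. lform k (D X) = 0"
  shows "\<exists>b\<in>F. lform b k \<noteq> 0"
proof (rule ccontr)
  assume "\<not> ?thesis"
  then have "k \<in> perp F" by (auto simp: perp_def lform_commute[of k])
  then have "k \<in> F" using mem_isotropic_plane_of_transverse[OF assms(1-4) _ k(2)] by blast
  then show False using assms(1) k(1) by (auto simp: isotropic_plane_def isotropic_def)
qed

text \<open>With \<open>W\<close> spanned by \<open>a\<close> and the range of \<open>D\<close>, the quotient of \<open>W\<^sup>\<bottom>\<close> by the line
  of \<open>a\<close> has signature (1,1) and contains \<open>k\<close>. It has just two lightlike lines, which the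
  reflection in \<open>k\<close> exchanges. They correspond to the isotropic planes through \<open>a\<close>
  orthogonal to the range of \<open>D\<close>.\<close>

lemma isotropic_planes_over_surface_element:
  fixes D :: "real^2 \<Rightarrow> r42"
  assumes F: "isotropic_plane F" and D: "linear D" "\<And>X. D X \<in> perp F"
    "\<And>X. D X \<in> F \<Longrightarrow> X = 0"
    and k: "lform k k \<noteq> 0" "\<And>X. lform k (D X) = 0"
    and a: "a \<in> F" "a \<noteq> 0" "lform a k = 0"
    and G: "isotropic_plane G" "a \<in> G" "\<And>X. D X \<in> perp G"
  shows "G = F \<or> G = blinfun_apply (reflection k) ` F"
proof -
  have sF: "subspace F" "dim F = 2" "isotropic F" and sG: "subspace G" "dim G = 2" "isotropic G"
    using F G(1) by (auto simp: isotropic_plane_def)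
  obtain b where b: "b \<in> F" "span {a, b} = F" using ex_plane_basis[OF sF(1,2) a(1,2)] .
  obtain c where c: "c \<in> G" "span {a, c} = G" using ex_plane_basis[OF sG(1,2) G(2) a(2)] .
  have bk: "lform b k \<noteq> 0"
  proof
    assume bk0: "lform b k = 0"
    have "subspace {v. lform v k = 0}"
      by (rule subspaceI) (auto simp: lform.zero_left lform.add_left lform.scaleR_left)
    then have "span {a, b} \<subseteq> {v. lform v k = 0}"
      using a(3) bk0 by (intro span_minimal) auto
    then show False using b(2) transverse_plane_not_orthogonal[OF F D k] by auto
  qed
  \<comment> \<open>Subtracting this multiple of \<open>k\<close> from \<open>c\<close> makes it orthogonal to \<open>b\<close>, and so puts it
    into \<open>F\<close>. As \<open>c\<close> is lightlike, the multiple is zero or the one that the reflection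
    produces.\<close>
  define \<mu> where "\<mu> = lform c b / lform k b"
  define w where "w = c - \<mu> *\<^sub>R k"
  have ca: "lform c a = 0" and cc: "lform c c = 0"
    using sG(3) c(1) G(2) by (auto simp: isotropic_def)
  have wa: "lform a w = 0" "lform b w = 0"
    using ca a(3) bk lform_commute[of b k] lform_commute[of b c] lform_commute[of a c]
    by (simp_all add: w_def \<mu>_def lform.diff_right lform.scaleR_right)
  have "subspace {v. lform v w = 0}"
    by (rule subspaceI) (auto simp: lform.zero_left lform.add_left lform.scaleR_left)
  then have "span {a, b} \<subseteq> {v. lform v w = 0}" using wa by (intro span_minimal) auto
  then have wF: "w \<in> perp F" using b(2) by (auto simp: perp_def lform_commute[of w])
  have "lform c (D X) = 0" for X using G(3) c(1) by (simp add: perp_def lform_commute[of c])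
  then have "lform w (D X) = 0" for X
    using k(2) by (simp add: w_def lform.diff_left lform.scaleR_left)
  then have w: "w \<in> F" using mem_isotropic_plane_of_transverse[OF F D wF] by blast
  have cw: "c = w + \<mu> *\<^sub>R k" by (simp add: w_def)
  have "lform w w = 0" using w sF(3) by (auto simp: isotropic_def)
  then have "\<mu> * (2 * lform w k + \<mu> * lform k k) = 0"
    using cc by (simp add: cw lform.add_left lform.add_right lform.scaleR_left lform.scaleR_right
        lform_commute[of k w] algebra_simps)
  then have "\<mu> = 0 \<or> 2 * lform w k + \<mu> * lform k k = 0" by simp
  then consider "\<mu> = 0" | "\<mu> = - (2 * lform w k / lform k k)"
    using k(1) by (auto simp: divide_simps algebra_simps add_eq_0_iff)
  then show ?thesis
  proof cases
    case 1
    then have "span {a, c} \<subseteq> F" using w a(1) sF(1) by (intro span_minimal) (auto simp: cw)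
    then show ?thesis using c(2) sF sG subspace_dim_equal[of G F] by auto
  next
    case 2
    let ?R = "blinfun_apply (reflection k)"
    have "?R w = c" by (simp add: reflection_apply cw 2)
    moreover have "?R a = a" using a(3) by (rule reflection_fixes)
    ultimately have "{a, c} \<subseteq> ?R ` F" using w a(1) by (metis empty_subsetI imageI insert_subset)
    then have "G \<subseteq> ?R ` F"
      using c(2) span_minimal subspace_image_blinfun[OF sF(1)] by blast
    then have "G = ?R ` F"
      using sG sF dim_orthogonal_image[OF orthogonal_reflection[OF k(1)], of F]
      by (intro subspace_dim_equal subspace_image_blinfun) auto
    then show ?thesis by blast
  qed
qed

section \<open>Skew maps from wedge products\<close>

lemma wedge_space_induct [consumes 1, case_names zero wedge add scale]:
  assumes "\<theta> \<in> wedge_space P Q"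
    and "Pr 0" and "\<And>a b. a \<in> P \<Longrightarrow> b \<in> Q \<Longrightarrow> Pr (wedge a b)"
    and "\<And>x y. Pr x \<Longrightarrow> Pr y \<Longrightarrow> Pr (x + y)" and "\<And>c x. Pr x \<Longrightarrow> Pr (c *\<^sub>R x)"
  shows "Pr \<theta>"
  using assms(1) unfolding wedge_space_def
proof (induction rule: span_induct_alt)
  case (step c x y) then show ?case using assms(3-5) by blast
qed (rule assms(2))

lemma wedge_space_mono: "P \<subseteq> P' \<Longrightarrow> Q \<subseteq> Q' \<Longrightarrow> wedge_space P Q \<subseteq> wedge_space P' Q'"
  unfolding wedge_space_def by (intro span_mono) blast

lemma wedge_space_kills:
  assumes "\<theta> \<in> wedge_space P Q" "v \<in> perp P" "v \<in> perp Q"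
  shows "blinfun_apply \<theta> v = 0"
  using assms(1)
proof (induction rule: wedge_space_induct)
  case (wedge a b)
  then have "lform a v = 0" "lform b v = 0"
    using assms by (auto simp: perp_def lform_commute)
  then show ?case by (simp add: wedge_apply)
qed (auto simp: blinfun.add_left blinfun.scaleR_left)

lemma wedge_space_range:
  assumes "\<theta> \<in> wedge_space P Q" "P \<subseteq> V" "Q \<subseteq> V" "subspace V"
  shows "blinfun_apply \<theta> v \<in> V"
  using assms(1)
proof (induction rule: wedge_space_induct)
  case (wedge a b)
  then show ?case using assms by (auto simp: wedge_apply intro!: subspace_diff subspace_scale)
qed (use assms(4) in \<open>auto simp: blinfun.add_left blinfun.scaleR_left subspace_0 subspace_add
    subspace_scale\<close>)

lemma wedge_space_skew:
  assumes "\<theta> \<in> wedge_space P Q"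
  shows "lform (\<theta> v) w = - lform v (\<theta> w)"
  using assms
proof (induction rule: wedge_space_induct)
  case (wedge a b)
  then show ?case
    by (simp add: wedge_apply lform.diff_left lform.diff_right lform.scaleR_left
        lform.scaleR_right lform_commute[of v a] lform_commute[of v b])
qed (auto simp: blinfun.add_left blinfun.scaleR_left lform.add_left lform.add_right
    lform.scaleR_left lform.scaleR_right lform.zero_left lform.zero_right)

text \<open>Elements of \<open>W \<and> W\<close> kill \<open>W\<close> when \<open>W\<close> is isotropic.\<close>

lemma gauge_orbit_image:
  assumes "isotropic W" "\<tau> \<in> wedge_space W W"
  shows "blinfun_apply (T o\<^sub>L (id_blinfun - t *\<^sub>R \<tau>)) ` W = blinfun_apply T ` W"
proof (rule image_cong[OF refl])
  fix v assume "v \<in> W"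
  then have "\<tau> v = 0"
    using wedge_space_kills[OF assms(2)] isotropic_subset_perp[OF assms(1)] by blast
  then show "(T o\<^sub>L (id_blinfun - t *\<^sub>R \<tau>)) v = T v"
    by (simp add: blinfun.diff_left blinfun.scaleR_left)
qed

section \<open>Calculus of smooth maps on a surface\<close>

lemma Ck_on_subset: "Ck_on n S h \<Longrightarrow> S' \<subseteq> S \<Longrightarrow> Ck_on n S' h"
  by (induction n arbitrary: h) (auto intro: continuous_on_subset)

lemma Ck_on_imp_continuous_on: "Ck_on n S h \<Longrightarrow> continuous_on S h"
  by (cases n) (auto intro!: differentiable_imp_continuous_on differentiable_at_imp_differentiable_on)

lemma Ck_on_SucD: "Ck_on (Suc n) S h \<Longrightarrow> Ck_on n S h"
proof (induction n arbitrary: h)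
  case 0
  then show ?case using Ck_on_imp_continuous_on by (auto simp del: Ck_on.simps(2))
next
  case (Suc n)
  then show ?case by (subst Ck_on.simps(2)) (metis Ck_on.simps(2))
qed

text \<open>Derivatives in \<open>Ck_on\<close> are full derivatives at the points of \<open>S\<close>, so the maps have to
  agree on neighbourhoods of these points.\<close>

lemma Ck_on_cong:
  assumes "open S" "Ck_on n S g" "\<And>x. x \<in> S \<Longrightarrow> g x = h x"
  shows "Ck_on n S h"
  using assms(2,3)
proof (induction n arbitrary: g h)
  case 0
  then show ?case by (simp add: continuous_on_eq)
next
  case (Suc n)
  have D: "frechet_derivative g (at x) v = frechet_derivative h (at x) v" if "x \<in> S" for x v
    using frechet_derivative_transform_within_open[of g x S h] Suc.prems that assms(1) by auto
  have "h differentiable (at x)" if "x \<in> S" for x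
  proof -
    obtain D where "(g has_derivative D) (at x)"
      using Suc.prems(1) \<open>x \<in> S\<close> by (auto simp: differentiable_def)
    then have "(h has_derivative D) (at x)"
      using Suc.prems(2) by (rule has_derivative_transform_within_open[OF _ assms(1) \<open>x \<in> S\<close>])
    then show ?thesis by (auto simp: differentiable_def)
  qed
  moreover have "Ck_on n S (\<lambda>x. frechet_derivative h (at x) v)" for v
  proof (rule Suc.IH)
    show "Ck_on n S (\<lambda>x. frechet_derivative g (at x) v)" using Suc.prems(1) by simp
  qed (rule D)
  ultimately show ?case by simp
qed

lemma Ck_on_const: "Ck_on n S (\<lambda>x. c)"
  by (induction n arbitrary: c) auto

lemma has_derivative_frechet:
  "h differentiable (at x) \<Longrightarrow> (h has_derivative frechet_derivative h (at x)) (at x)"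
  by (simp add: frechet_derivative_works[symmetric])

lemma Ck_on_add:
  assumes "open S" "Ck_on n S g" "Ck_on n S h"
  shows "Ck_on n S (\<lambda>x. g x + h x)"
  using assms(2,3)
proof (induction n arbitrary: g h)
  case 0
  then show ?case by (simp add: continuous_on_add)
next
  case (Suc n)
  have D: "((\<lambda>x. g x + h x) has_derivative
      (\<lambda>v. frechet_derivative g (at x) v + frechet_derivative h (at x) v)) (at x)"
    if "x \<in> S" for x
    using Suc.prems that by (intro has_derivative_add has_derivative_frechet) auto
  have "Ck_on n S (\<lambda>x. frechet_derivative g (at x) v + frechet_derivative h (at x) v)" for v
    using Suc by auto
  then have "Ck_on n S (\<lambda>x. frechet_derivative (\<lambda>x. g x + h x) (at x) v)" for v
    by (rule Ck_on_cong[OF assms(1)]) (simp add: frechet_derivative_at[OF D, symmetric])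
  then show ?case using D by (auto simp: differentiable_def)
qed

lemma Ck_on_linear:
  assumes "bounded_linear L" "open S" "Ck_on n S h"
  shows "Ck_on n S (\<lambda>x. L (h x))"
  using assms(3)
proof (induction n arbitrary: h)
  case 0
  then show ?case by (simp add: bounded_linear.continuous_on[OF assms(1)])
next
  case (Suc n)
  have D: "((\<lambda>x. L (h x)) has_derivative (\<lambda>v. L (frechet_derivative h (at x) v))) (at x)"
    if "x \<in> S" for x
    using Suc.prems that
    by (intro bounded_linear.has_derivative[OF assms(1)] has_derivative_frechet) auto
  have "Ck_on n S (\<lambda>x. L (frechet_derivative h (at x) v))" for v
    using Suc by auto
  then have "Ck_on n S (\<lambda>x. frechet_derivative (\<lambda>x. L (h x)) (at x) v)" for v
    by (rule Ck_on_cong[OF assms(2)]) (simp add: frechet_derivative_at[OF D, symmetric])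
  then show ?case using D by (auto simp: differentiable_def)
qed

lemma Ck_on_bilinear:
  assumes "bounded_bilinear B" "open S" "Ck_on n S g" "Ck_on n S h"
  shows "Ck_on n S (\<lambda>x. B (g x) (h x))"
  using assms(3,4)
proof (induction n arbitrary: g h)
  case 0
  then show ?case by (simp add: bounded_bilinear.continuous_on[OF assms(1)])
next
  case (Suc n)
  have D: "((\<lambda>x. B (g x) (h x)) has_derivative
      (\<lambda>v. B (g x) (frechet_derivative h (at x) v) + B (frechet_derivative g (at x) v) (h x)))
      (at x)" if "x \<in> S" for x
    using Suc.prems that
    by (intro bounded_bilinear.FDERIV[OF assms(1)] has_derivative_frechet) auto
  have "Ck_on n S (\<lambda>x. B (g x) (frechet_derivative h (at x) v) +
      B (frechet_derivative g (at x) v) (h x))" for v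
    using Suc.prems Ck_on_SucD[OF Suc.prems(1)] Ck_on_SucD[OF Suc.prems(2)]
    by (intro Ck_on_add assms(2) Suc.IH) auto
  then have "Ck_on n S (\<lambda>x. frechet_derivative (\<lambda>x. B (g x) (h x)) (at x) v)" for v
    by (rule Ck_on_cong[OF assms(2)]) (simp add: frechet_derivative_at[OF D, symmetric])
  then show ?case using D by (auto simp: differentiable_def)
qed

lemma smooth_map_subset: "smooth_map A U h \<Longrightarrow> V \<subseteq> U \<Longrightarrow> smooth_map A V h"
  unfolding smooth_map_def smooth_on_def by (meson Ck_on_subset Int_mono image_mono order_refl)

lemma local_section_mono:
  "(\<And>q. W q \<subseteq> W' q) \<Longrightarrow> local_section A W p \<sigma> \<Longrightarrow> local_section A W' p \<sigma>"
  unfolding local_section_def section_on_def by blast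

lemma derived_mono: "(\<And>q. W q \<subseteq> W' q) \<Longrightarrow> derived A W p \<subseteq> derived A W' p"
  unfolding derived_def by (intro span_mono Un_mono) (blast intro: local_section_mono)+

context
  fixes A :: "('a::{t2_space,second_countable_topology}) chart set"
  assumes atlas: "smooth_atlas A"
begin

lemma chart_homeomorphism:
  assumes "c \<in> A"
  shows "homeomorphism (fst c) (snd c ` fst c) (snd c) (param c)" "open (fst c)"
    "open (snd c ` fst c)"
  using assms atlas by (auto simp: smooth_atlas_def is_chart_def)

lemma param_chart: "c \<in> A \<Longrightarrow> p \<in> fst c \<Longrightarrow> param c (snd c p) = p"
  by (meson chart_homeomorphism(1) homeomorphism_apply1)

lemma open_chart_image:
  assumes "c \<in> A" "open U" shows "open (snd c ` (fst c \<inter> U))"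
proof -
  have "openin (top_of_set (snd c ` fst c)) (snd c ` (fst c \<inter> U))"
    using assms by (intro homeomorphism_imp_open_map[OF chart_homeomorphism(1)]) auto
  then show ?thesis using chart_homeomorphism(3)[OF assms(1)] openin_open_trans by blast
qed

lemma chart_at: "chart_at A p \<in> A" "p \<in> fst (chart_at A p)"
proof -
  have "\<exists>c. c \<in> A \<and> p \<in> fst c" using atlas by (auto simp: smooth_atlas_def)
  from someI_ex[OF this] show "chart_at A p \<in> A" "p \<in> fst (chart_at A p)"
    by (auto simp: chart_at_def)
qed

lemma param_chart_at [simp]: "param (chart_at A p) (snd (chart_at A p) p) = p"
  by (simp add: param_chart chart_at)

lemma smooth_map_cong:
  assumes "open U" "smooth_map A U g" "\<And>p. p \<in> U \<Longrightarrow> g p = h p"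
  shows "smooth_map A U h"
  unfolding smooth_map_def smooth_on_def
proof (intro ballI allI)
  fix c n assume c: "c \<in> A"
  show "Ck_on n (snd c ` (fst c \<inter> U)) (h \<circ> param c)"
  proof (rule Ck_on_cong[OF open_chart_image[OF c assms(1)]])
    show "Ck_on n (snd c ` (fst c \<inter> U)) (g \<circ> param c)"
      using assms(2) c by (simp add: smooth_map_def smooth_on_def)
  qed (use c assms(3) in \<open>auto simp: param_chart\<close>)
qed

lemma smooth_map_const: "smooth_map A U (\<lambda>p. c)"
  by (simp add: smooth_map_def smooth_on_def o_def Ck_on_const)

lemma smooth_map_add:
  assumes "open U" "smooth_map A U g" "smooth_map A U h"
  shows "smooth_map A U (\<lambda>p. g p + h p)"
  using assms unfolding smooth_map_def smooth_on_def
  by (auto simp: o_def intro!: Ck_on_add open_chart_image)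

lemma smooth_map_linear:
  assumes "bounded_linear L" "open U" "smooth_map A U h"
  shows "smooth_map A U (\<lambda>p. L (h p))"
  using assms(2,3) unfolding smooth_map_def smooth_on_def
  by (auto simp: o_def intro!: Ck_on_linear[OF assms(1)] open_chart_image)

lemma smooth_map_bilinear:
  assumes "bounded_bilinear B" "open U" "smooth_map A U g" "smooth_map A U h"
  shows "smooth_map A U (\<lambda>p. B (g p) (h p))"
  using assms(2-4) unfolding smooth_map_def smooth_on_def
  by (auto simp: o_def intro!: Ck_on_bilinear[OF assms(1)] open_chart_image)

lemma smooth_map_sum:
  assumes "open U" "finite I" "\<And>i. i \<in> I \<Longrightarrow> smooth_map A U (h i)"
  shows "smooth_map A U (\<lambda>p. \<Sum>i\<in>I. h i p)"
  using assms(2,3)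
  by (induction rule: finite_induct) (auto intro!: smooth_map_const smooth_map_add assms(1))

lemma smooth_map_imp_continuous_on:
  assumes "open U" "smooth_map A U h"
  shows "continuous_on U h"
proof -
  have "continuous (at p) h" if p: "p \<in> U" for p
  proof -
    let ?c = "chart_at A p"
    have "continuous_on (snd ?c ` (fst ?c \<inter> U)) (h \<circ> param ?c)"
      using assms(2) chart_at(1)[of p] Ck_on_imp_continuous_on[of 0]
      unfolding smooth_map_def smooth_on_def by blast
    moreover have "continuous_on (fst ?c \<inter> U) (snd ?c)"
      using chart_homeomorphism(1)[OF chart_at(1)[of p]]
      by (intro continuous_on_subset[OF _ Int_lower1]) (simp add: homeomorphism_def)
    ultimately have "continuous_on (fst ?c \<inter> U) ((h \<circ> param ?c) \<circ> snd ?c)"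
      using continuous_on_compose by blast
    then have "continuous_on (fst ?c \<inter> U) h"
      by (rule continuous_on_eq) (simp add: param_chart chart_at)
    moreover have "open (fst ?c \<inter> U)" "p \<in> fst ?c \<inter> U"
      using chart_homeomorphism(2)[OF chart_at(1)] assms(1) p chart_at(2) by auto
    ultimately show ?thesis by (simp add: continuous_on_eq_continuous_at)
  qed
  then show ?thesis by (simp add: continuous_at_imp_continuous_on)
qed

section \<open>Rules for derivatives\<close>

lemma smooth_map_differentiable:
  assumes "smooth_map A U h" "p \<in> U" "c \<in> A" "p \<in> fst c"
  shows "(\<lambda>x. h (param c x)) differentiable (at (snd c p))"
proof -
  have "Ck_on (Suc 0) (snd c ` (fst c \<inter> U)) (h \<circ> param c)"
    using assms(1,3) unfolding smooth_map_def smooth_on_def by blast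
  then show ?thesis using assms by (auto simp: o_def)
qed

lemma has_derivative_mderiv:
  assumes "smooth_map A U h" "p \<in> U"
  shows "((\<lambda>x. h (param (chart_at A p) x)) has_derivative mderiv A h p)
    (at (snd (chart_at A p) p))"
  using smooth_map_differentiable[OF assms chart_at[of p]]
  by (simp add: frechet_derivative_works mderiv_def[abs_def] o_def)

lemma mderiv_eqI:
  assumes "((\<lambda>x. h (param (chart_at A p) x)) has_derivative D) (at (snd (chart_at A p) p))"
  shows "mderiv A h p X = D X"
  using frechet_derivative_at[OF assms] by (simp add: mderiv_def o_def)

lemma linear_mderiv: "smooth_map A U h \<Longrightarrow> p \<in> U \<Longrightarrow> linear (mderiv A h p)"
  using has_derivative_mderiv has_derivative_linear by blast

lemma mderiv_cong:
  assumes "smooth_map A N g" "open N" "p \<in> N" "\<And>q. q \<in> N \<Longrightarrow> g q = h q"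
  shows "mderiv A h p X = mderiv A g p X"
proof (rule mderiv_eqI)
  let ?c = "chart_at A p"
  show "((\<lambda>x. h (param ?c x)) has_derivative mderiv A g p) (at (snd ?c p))"
    using assms
    by (intro has_derivative_transform_within_open[OF has_derivative_mderiv
          open_chart_image[OF chart_at(1)]])
      (auto simp: param_chart chart_at)
qed

lemma mderiv_const [simp]: "mderiv A (\<lambda>p. c) p X = 0"
  by (rule mderiv_eqI) simp

lemma mderiv_add:
  assumes "smooth_map A U g" "smooth_map A V h" "p \<in> U" "p \<in> V"
  shows "mderiv A (\<lambda>q. g q + h q) p X = mderiv A g p X + mderiv A h p X"
  by (rule mderiv_eqI)
    (intro has_derivative_add has_derivative_mderiv[OF assms(1,3)] has_derivative_mderiv[OF assms(2,4)])

lemma mderiv_affine: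
  assumes "bounded_linear L" "smooth_map A U h" "p \<in> U"
  shows "mderiv A (\<lambda>q. c + L (h q)) p X = L (mderiv A h p X)"
proof (rule mderiv_eqI)
  show "((\<lambda>x. c + L (h (param (chart_at A p) x))) has_derivative (\<lambda>X. L (mderiv A h p X)))
    (at (snd (chart_at A p) p))"
    using has_derivative_add[OF has_derivative_const bounded_linear.has_derivative[OF assms(1)
          has_derivative_mderiv[OF assms(2,3)]], of c] by simp
qed

lemma mderiv_linear:
  assumes "bounded_linear L" "smooth_map A U h" "p \<in> U"
  shows "mderiv A (\<lambda>q. L (h q)) p X = L (mderiv A h p X)"
  using mderiv_affine[OF assms, of 0] by simp

lemma mderiv_bilinear:
  assumes "bounded_bilinear B" "smooth_map A U g" "smooth_map A V h" "p \<in> U" "p \<in> V"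
  shows "mderiv A (\<lambda>q. B (g q) (h q)) p X =
    B (g p) (mderiv A h p X) + B (mderiv A g p X) (h p)"
proof (rule mderiv_eqI)
  show "((\<lambda>x. B (g (param (chart_at A p) x)) (h (param (chart_at A p) x))) has_derivative
    (\<lambda>X. B (g p) (mderiv A h p X) + B (mderiv A g p X) (h p))) (at (snd (chart_at A p) p))"
    using bounded_bilinear.FDERIV[OF assms(1) has_derivative_mderiv[OF assms(2,4)]
        has_derivative_mderiv[OF assms(3,5)]] by simp
qed

text \<open>\<open>mderiv\<close> at different points is computed in different charts, so local constancy
  is read off in one chart after a change of coordinates.\<close>

lemma mderiv_zero_imp_constant:
  fixes h :: "'a \<Rightarrow> 'w::real_normed_vector"
  assumes U: "open U" "connected U" and h: "smooth_map A U h"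
    and zero: "\<And>p X. p \<in> U \<Longrightarrow> mderiv A h p X = 0" and p: "p \<in> U" and q: "q \<in> U"
  shows "h q = h p"
proof -
  have loc: "\<exists>T. open T \<and> a \<in> T \<and> (\<forall>b\<in>T. h b = h a)" if a: "a \<in> U" for a
  proof -
    let ?c = "chart_at A a"
    let ?S = "snd ?c ` (fst ?c \<inter> U)"
    have oS: "open ?S" and aS: "snd ?c a \<in> ?S"
      using open_chart_image[OF chart_at(1) U(1)] chart_at(2) a by auto
    have D: "((\<lambda>x. h (param ?c x)) has_derivative (\<lambda>v. 0)) (at y)" if y: "y \<in> ?S" for y
    proof -
      obtain b where b: "b \<in> fst ?c" "b \<in> U" "y = snd ?c b" using y by auto
      let ?d = "chart_at A b"
      have "Ck_on (Suc 0) (snd ?c ` (fst ?c \<inter> fst ?d)) (snd ?d \<circ> param ?c)"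
        using atlas chart_at(1) unfolding smooth_atlas_def smooth_on_def by blast
      then have "(snd ?d \<circ> param ?c) differentiable (at y)"
        using b chart_at(2)[of b] by auto
      then obtain E where E: "((snd ?d \<circ> param ?c) has_derivative E) (at y)"
        by (auto simp: differentiable_def)
      have "(snd ?d \<circ> param ?c) y = snd ?d b" using b by (simp add: param_chart chart_at)
      moreover have "((\<lambda>x. h (param ?d x)) has_derivative (\<lambda>v. 0)) (at (snd ?d b))"
      proof -
        have "mderiv A h b = (\<lambda>v. 0)" using zero[OF b(2)] by (rule ext)
        then show ?thesis using has_derivative_mderiv[OF h b(2)] by simp
      qed
      ultimately have "((\<lambda>x. h (param ?d (snd ?d (param ?c x)))) has_derivative (\<lambda>v. 0)) (at y)"
        using diff_chain_at[OF E, of "\<lambda>x. h (param ?d x)" "\<lambda>v. 0"] by (simp add: o_def)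
      then show ?thesis
      proof (rule has_derivative_transform_within_open)
        show "open (snd ?c ` (fst ?c \<inter> fst ?d))"
          by (intro open_chart_image chart_at chart_homeomorphism)
      qed (use b chart_at in \<open>auto simp: param_chart\<close>)
    qed
    obtain e where e: "e > 0" "ball (snd ?c a) e \<subseteq> ?S"
      using oS aS open_contains_ball by blast
    let ?T = "fst ?c \<inter> snd ?c -` ball (snd ?c a) e"
    have "open ?T"
      using chart_homeomorphism[OF chart_at(1)[of a]]
      by (intro continuous_open_preimage) (auto simp: homeomorphism_def)
    moreover have "a \<in> ?T" using e(1) chart_at(2) by simp
    moreover have "h b = h a" if b: "b \<in> ?T" for b
    proof -
      have "\<exists>k. \<forall>x\<in>ball (snd ?c a) e. h (param ?c x) = k"
      proof (rule has_derivative_zero_constant)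
        fix x assume "x \<in> ball (snd ?c a) e"
        then have "x \<in> ?S" using e(2) by blast
        from has_derivative_at_withinI[OF D[OF this]]
        show "((\<lambda>x. h (param ?c x)) has_derivative (\<lambda>v. 0)) (at x within ball (snd ?c a) e)" .
      qed simp
      moreover have "snd ?c a \<in> ball (snd ?c a) e" "snd ?c b \<in> ball (snd ?c a) e"
        using b e(1) by auto
      ultimately have "h (param ?c (snd ?c b)) = h (param ?c (snd ?c a))" by metis
      then show ?thesis using b by (simp add: param_chart chart_at)
    qed
    ultimately show ?thesis by blast
  qed
  have "\<forall>a\<in>U. eventually (\<lambda>b. h a = h b) (at a within U)"
    using loc by (metis (mono_tags, lifting) eventually_at_topological)
  then show ?thesis using connected_local_const[OF U(2) q p, of h] by blast
qed

section \<open>Sections\<close>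

lemma smooth_map_apply:
  fixes T :: "'a \<Rightarrow> 'v::real_normed_vector \<Rightarrow>\<^sub>L 'w::real_normed_vector"
  shows "open U \<Longrightarrow> smooth_map A U T \<Longrightarrow> smooth_map A U \<sigma> \<Longrightarrow> smooth_map A U (\<lambda>p. T p (\<sigma> p))"
  by (rule smooth_map_bilinear[OF bounded_bilinear_blinfun_apply])

lemma smooth_map_inv_orthogonal:
  assumes U: "open U" and T: "smooth_map A U T" "\<And>p. p \<in> U \<Longrightarrow> orthogonal42 (T p)"
    and \<psi>: "smooth_map A U \<psi>"
  shows "smooth_map A U (\<lambda>p. inv (blinfun_apply (T p)) (\<psi> p))"
proof (rule smooth_map_cong[OF U])
  have "smooth_map A U (\<lambda>p. lform (T p b) (\<psi> p) *\<^sub>R timeflip b)" for b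
    by (intro smooth_map_linear[OF bounded_linear_scaleR_left U]
        smooth_map_bilinear[OF bounded_bilinear_lform U] smooth_map_apply U T \<psi>
        smooth_map_const)
  then show "smooth_map A U (\<lambda>p. \<Sum>b\<in>Basis. lform (T p b) (\<psi> p) *\<^sub>R timeflip b)"
    by (intro smooth_map_sum U) auto
qed (simp add: inv_orthogonal T)

lemma lform_mderiv_eq_0:
  assumes "smooth_map A N \<sigma>" "open N" "p \<in> N" "\<And>q. q \<in> N \<Longrightarrow> lform (\<sigma> q) k = 0"
  shows "lform (mderiv A \<sigma> p X) k = 0"
proof -
  have "mderiv A (\<lambda>q. lform (\<sigma> q) k) p X = lform (mderiv A \<sigma> p X) k"
    by (rule mderiv_linear[OF lform.bounded_linear_left assms(1,3)])
  moreover have "mderiv A (\<lambda>q. lform (\<sigma> q) k) p X = mderiv A (\<lambda>q. 0::real) p X"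
    by (rule mderiv_cong[OF smooth_map_const assms(2,3)]) (simp add: assms(4))
  ultimately show ?thesis by simp
qed

lemma derived_subset_perp:
  assumes "\<And>q. W q \<subseteq> perp {k}" shows "derived A W p \<subseteq> perp {k}"
  unfolding derived_def
proof (intro span_minimal subspace_perp Un_least)
  show "{\<sigma> p |\<sigma>. local_section A W p \<sigma>} \<subseteq> perp {k}"
    using assms unfolding local_section_def section_on_def by blast
  show "{mderiv A \<sigma> p X |\<sigma> X. local_section A W p \<sigma>} \<subseteq> perp {k}"
  proof
    fix v assume "v \<in> {mderiv A \<sigma> p X |\<sigma> X. local_section A W p \<sigma>}"
    then obtain \<sigma> X N where v: "v = mderiv A \<sigma> p X" and "open N" "p \<in> N" "smooth_map A N \<sigma>"
      "\<And>q. q \<in> N \<Longrightarrow> \<sigma> q \<in> W q"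
      unfolding local_section_def section_on_def by blast
    moreover have "lform (\<sigma> q) k = 0" if "q \<in> N" for q
      using assms[of q] calculation(5)[OF that] by (auto simp: perp_def)
    ultimately show "v \<in> perp {k}"
      using lform_mderiv_eq_0[of N \<sigma> p k X] by (simp add: perp_def)
  qed
qed

text \<open>Difference quotients of a lightlike map at a zero are lightlike, and so is their limit.\<close>

lemma mderiv_lightlike_at_zero:
  assumes \<mu>: "smooth_map A N \<mu>" "open N" "p \<in> N" "\<mu> p = 0"
    and null: "\<And>q. q \<in> N \<Longrightarrow> lform (\<mu> q) (\<mu> q) = 0"
  shows "lform (mderiv A \<mu> p X) (mderiv A \<mu> p X) = 0"
proof -
  let ?c = "chart_at A p" and ?D = "mderiv A \<mu> p X"
  let ?x = "snd ?c p"
  define \<phi> where "\<phi> h = \<mu> (param ?c (?x + h *\<^sub>R X))" for h :: real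
  have "((\<lambda>h. ?x + h *\<^sub>R X) has_derivative (\<lambda>h. h *\<^sub>R X)) (at 0)"
    by (auto intro!: derivative_eq_intros)
  from diff_chain_at[OF this, of "\<lambda>x. \<mu> (param ?c x)" "mderiv A \<mu> p"]
  have "(\<phi> has_derivative (\<lambda>h. mderiv A \<mu> p (h *\<^sub>R X))) (at 0)"
    using has_derivative_mderiv[OF \<mu>(1,3)] by (simp add: o_def \<phi>_def[abs_def])
  then have "(\<phi> has_vector_derivative ?D) (at 0)"
    using linear_mderiv[OF \<mu>(1,3)] by (simp add: has_vector_derivative_def linear_scale)
  then have "(\<lambda>h. norm (\<phi> h - h *\<^sub>R ?D) / norm h) \<midarrow>0\<rightarrow> 0"
    using \<mu>(4) by (simp add: has_vector_derivative_def has_derivative_at \<phi>_def)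
  moreover have "norm (\<phi> h - h *\<^sub>R ?D) / norm h = norm ((1 / h) *\<^sub>R \<phi> h - ?D)" if "h \<noteq> 0" for h
  proof -
    have "(1 / h) *\<^sub>R \<phi> h - ?D = (1 / h) *\<^sub>R (\<phi> h - h *\<^sub>R ?D)"
      using that by (simp add: scaleR_diff_right)
    then show ?thesis by simp
  qed
  ultimately have "(\<lambda>h. norm ((1 / h) *\<^sub>R \<phi> h - ?D)) \<midarrow>0\<rightarrow> 0"
    by (subst (asm) LIM_equal) auto
  then have lim: "(\<lambda>h. (1 / h) *\<^sub>R \<phi> h) \<midarrow>0\<rightarrow> ?D"
    by (rule LIM_zero_cancel[OF tendsto_norm_zero_cancel])
  have "eventually (\<lambda>h. ?x + h *\<^sub>R X \<in> snd ?c ` (fst ?c \<inter> N)) (at 0)"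
  proof (rule topological_tendstoD)
    show "((\<lambda>h. ?x + h *\<^sub>R X) \<longlongrightarrow> ?x) (at 0)" by (auto intro!: tendsto_eq_intros)
    show "open (snd ?c ` (fst ?c \<inter> N))" by (rule open_chart_image[OF chart_at(1) \<mu>(2)])
    show "?x \<in> snd ?c ` (fst ?c \<inter> N)" using chart_at(2) \<mu>(3) by auto
  qed
  then have "eventually (\<lambda>h. lform ((1 / h) *\<^sub>R \<phi> h) ((1 / h) *\<^sub>R \<phi> h) = 0) (at 0)"
  proof (rule eventually_mono)
    fix h assume "?x + h *\<^sub>R X \<in> snd ?c ` (fst ?c \<inter> N)"
    then have "lform (\<phi> h) (\<phi> h) = 0" using null by (auto simp: \<phi>_def param_chart chart_at)
    then show "lform ((1 / h) *\<^sub>R \<phi> h) ((1 / h) *\<^sub>R \<phi> h) = 0"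
      by (simp add: lform.scaleR_left lform.scaleR_right)
  qed
  then have "((\<lambda>h. lform ((1 / h) *\<^sub>R \<phi> h) ((1 / h) *\<^sub>R \<phi> h)) \<longlongrightarrow> 0) (at 0)"
    by (rule tendsto_eventually)
  then show ?thesis using lform.tendsto[OF lim lim] tendsto_unique[OF trivial_limit_at] by blast
qed

end

section \<open>Gauge transformations\<close>

context
  fixes A :: "('a::{t2_space,second_countable_topology}) chart set"
  assumes atlas: "smooth_atlas A"
begin

text \<open>The equation \<open>T \<cdot> (d + t\<theta>) = d\<close> amounts to \<open>dT = t T \<theta>\<close>, by the product rule
  for \<open>\<psi> = T (T\<^sup>-\<^sup>1 \<psi>)\<close>.\<close>

lemma trivialising_gauge_iff:
  assumes U: "open U"
  shows "trivialising_gauge A U \<theta> t T \<longleftrightarrow>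
    smooth_map A U T \<and> (\<forall>p\<in>U. orthogonal42 (T p)) \<and>
    (\<forall>p\<in>U. \<forall>X. mderiv A T p X = t *\<^sub>R (T p o\<^sub>L \<theta> p X))" (is "_ \<longleftrightarrow> ?R")
proof
  assume triv: "trivialising_gauge A U \<theta> t T"
  then have T: "smooth_map A U T" "\<And>p. p \<in> U \<Longrightarrow> orthogonal42 (T p)"
    by (auto simp: trivialising_gauge_def)
  have "mderiv A T p X = t *\<^sub>R (T p o\<^sub>L \<theta> p X)" if p: "p \<in> U" for p X
  proof (rule blinfun_eqI)
    fix c
    have inv: "inv (blinfun_apply (T q)) (T q c) = c" if "q \<in> U" for q
      using inj_orthogonal[OF T(2)[OF that]] by (rule inv_f_f)
    have "smooth_map A U (\<lambda>q. T q c)"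
      by (intro smooth_map_apply[OF atlas] U T smooth_map_const[OF atlas])
    then have "gauge_action T (pencil A \<theta> t) (\<lambda>q. T q c) p X = mderiv A (\<lambda>q. T q c) p X"
      using triv p by (simp add: trivialising_gauge_def)
    moreover have "mderiv A (\<lambda>q. inv (blinfun_apply (T q)) (T q c)) p X = mderiv A (\<lambda>q. c) p X"
      by (rule mderiv_cong[OF atlas smooth_map_const[OF atlas] U p]) (simp add: inv)
    moreover have "mderiv A (\<lambda>q. T q c) p X = mderiv A T p X c"
      by (rule mderiv_linear[OF atlas blinfun.bounded_linear_left T(1) p])
    ultimately show "mderiv A T p X c = (t *\<^sub>R (T p o\<^sub>L \<theta> p X)) c"
      by (simp add: gauge_action_def pencil_def inv[OF p] mderiv_const[OF atlas]
          blinfun.scaleR_left blinfun.scaleR_right)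
  qed
  then show ?R using T by blast
next
  assume R: ?R
  have "gauge_action T (pencil A \<theta> t) \<psi> p X = mderiv A \<psi> p X"
    if \<psi>: "smooth_map A U \<psi>" and p: "p \<in> U" for \<psi> p X
  proof -
    let ?\<phi> = "\<lambda>q. inv (blinfun_apply (T q)) (\<psi> q)"
    have \<phi>: "smooth_map A U ?\<phi>"
      using R by (intro smooth_map_inv_orthogonal[OF atlas] U \<psi>) auto
    have "T q (?\<phi> q) = \<psi> q" if "q \<in> U" for q
      using bij_orthogonal[of "T q"] R that by (simp add: bij_is_surj surj_f_inv_f)
    then have "mderiv A (\<lambda>q. T q (?\<phi> q)) p X = mderiv A \<psi> p X"
      by (intro mderiv_cong[OF atlas \<psi> U p]) simp
    moreover have "mderiv A (\<lambda>q. T q (?\<phi> q)) p X =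
        T p (mderiv A ?\<phi> p X) + mderiv A T p X (?\<phi> p)"
      using R by (intro mderiv_bilinear[OF atlas bounded_bilinear_blinfun_apply _ \<phi> p p]) auto
    ultimately show ?thesis
      using R p by (simp add: gauge_action_def pencil_def blinfun.add_right blinfun.scaleR_right
          blinfun.scaleR_left)
  qed
  then show "trivialising_gauge A U \<theta> t T" using R by (simp add: trivialising_gauge_def)
qed

lemma mderiv_gauge:
  assumes "trivialising_gauge A U \<theta> t T" "open U" "p \<in> U" "smooth_map A V \<sigma>" "p \<in> V"
    and "\<theta> p X (\<sigma> p) = 0"
  shows "mderiv A (\<lambda>q. T q (\<sigma> q)) p X = T p (mderiv A \<sigma> p X)"
proof -
  have T: "smooth_map A U T" "mderiv A T p X = t *\<^sub>R (T p o\<^sub>L \<theta> p X)"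
    using assms(1,3) by (auto simp: trivialising_gauge_iff[OF assms(2)])
  show ?thesis
    using mderiv_bilinear[OF atlas bounded_bilinear_blinfun_apply T(1) assms(4,3,5), of X]
    by (simp add: T(2) assms(6) blinfun.scaleR_left)
qed

lemma trivialising_gauge_compose:
  assumes "trivialising_gauge A U \<theta> t T" "open U" "orthogonal42 g"
  shows "trivialising_gauge A U \<theta> t (\<lambda>p. g o\<^sub>L T p)"
proof -
  have T: "smooth_map A U T" "\<And>p. p \<in> U \<Longrightarrow> orthogonal42 (T p)"
    "\<And>p X. p \<in> U \<Longrightarrow> mderiv A T p X = t *\<^sub>R (T p o\<^sub>L \<theta> p X)"
    using assms(1) by (auto simp: trivialising_gauge_iff[OF assms(2)])
  have L: "bounded_linear (\<lambda>h. g o\<^sub>L h)"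
    by (rule bounded_bilinear.bounded_linear_right[OF bounded_bilinear_blinfun_compose])
  have "mderiv A (\<lambda>p. g o\<^sub>L T p) p X = t *\<^sub>R ((g o\<^sub>L T p) o\<^sub>L \<theta> p X)" if "p \<in> U" for p X
    using mderiv_linear[OF atlas L T(1) that] T(3)[OF that]
    by (auto intro!: blinfun_eqI simp: blinfun.scaleR_left blinfun.scaleR_right)
  then show ?thesis
    using smooth_map_linear[OF atlas L assms(2) T(1)] T(2) assms(3)
    by (simp add: trivialising_gauge_iff[OF assms(2)] orthogonal_compose)
qed

text \<open>Along the gauge orbit, \<open>1 - t\<tau> = exp (- t\<tau>)\<close> intertwines the connections: all products
  of \<open>\<tau>\<close> with the potentials vanish, because \<open>\<tau>\<close> kills \<open>f\<^sup>\<bottom>\<close>, where they take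
  their values, and has values in \<open>f\<close>, which they kill.\<close>

lemma trivialising_gauge_orbit:
  assumes U: "open U" and triv: "trivialising_gauge A U \<theta> t T"
    and f: "\<And>p. p \<in> U \<Longrightarrow> subspace (f p)" "\<And>p. p \<in> U \<Longrightarrow> isotropic (f p)"
    and \<theta>: "\<And>p X. p \<in> U \<Longrightarrow> \<theta> p X \<in> wedge_space (f p) (perp (f p))"
    and \<theta>': "\<And>p X. p \<in> U \<Longrightarrow> \<theta>' p X \<in> wedge_space (f p) (perp (f p))"
    and \<tau>: "smooth_map A U \<tau>" "\<And>p. p \<in> U \<Longrightarrow> \<tau> p \<in> wedge_space (f p) (f p)"
    and eq: "\<And>p X. p \<in> U \<Longrightarrow> \<theta>' p X = \<theta> p X - mderiv A \<tau> p X"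
  shows "trivialising_gauge A U \<theta>' t (\<lambda>p. T p o\<^sub>L (id_blinfun - t *\<^sub>R \<tau> p))"
proof -
  have T: "smooth_map A U T" "\<And>p. p \<in> U \<Longrightarrow> orthogonal42 (T p)"
    "\<And>p X. p \<in> U \<Longrightarrow> mderiv A T p X = t *\<^sub>R (T p o\<^sub>L \<theta> p X)"
    using triv by (auto simp: trivialising_gauge_iff[OF U])
  define E where "E p = id_blinfun + (- t) *\<^sub>R \<tau> p" for p
  have E_eq: "id_blinfun - t *\<^sub>R \<tau> p = E p" for p by (simp add: E_def)
  have \<tau>_range: "\<tau> p v \<in> f p" if "p \<in> U" for p v
    using wedge_space_range[OF \<tau>(2)[OF that]] f(1)[OF that] by blast
  have \<tau>_kills: "\<tau> p v = 0" if "p \<in> U" "v \<in> perp (f p)" for p v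
    using wedge_space_kills[OF \<tau>(2)] that by blast
  have \<theta>_kills: "\<theta> p X v = 0" if "p \<in> U" "v \<in> f p" for p X v
  proof (rule wedge_space_kills[OF \<theta>[OF that(1)]])
    show "v \<in> perp (f p)" using isotropic_subset_perp[OF f(2)[OF that(1)]] that(2) by blast
    show "v \<in> perp (perp (f p))"
      using that(2) by (auto simp: perp_def) (metis lform_commute)
  qed
  have \<theta>'_range: "\<theta>' p X v \<in> perp (f p)" if "p \<in> U" for p X v
    using wedge_space_range[OF \<theta>'[OF that]] isotropic_subset_perp[OF f(2)[OF that]] subspace_perp
    by blast
  have L: "bounded_linear (\<lambda>h::endo42. (- t) *\<^sub>R h)" by (rule bounded_linear_scaleR_right)
  have sE: "smooth_map A U E"
    unfolding E_def[abs_def]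
    by (intro smooth_map_add[OF atlas U] smooth_map_const[OF atlas]
        smooth_map_linear[OF atlas L U \<tau>(1)])
  have "orthogonal42 (E p)" if p: "p \<in> U" for p
    unfolding orthogonal42_def
  proof (intro allI)
    fix x y
    have "lform (\<tau> p x) (\<tau> p y) = 0"
      using f(2)[OF p] \<tau>_range[OF p] by (auto simp: isotropic_def)
    then show "lform (E p x) (E p y) = lform x y"
      using wedge_space_skew[OF \<tau>(2)[OF p], of x y]
      by (simp add: E_def blinfun.diff_left blinfun.scaleR_left lform.diff_left
          lform.diff_right lform.scaleR_left lform.scaleR_right)
  qed
  then have "\<And>p. p \<in> U \<Longrightarrow> orthogonal42 (T p o\<^sub>L E p)" using T(2) by (simp add: orthogonal_compose)
  moreover have "smooth_map A U (\<lambda>p. T p o\<^sub>L E p)"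
    by (intro smooth_map_bilinear[OF atlas bounded_bilinear_blinfun_compose U T(1) sE])
  moreover have "mderiv A (\<lambda>p. T p o\<^sub>L E p) p X = t *\<^sub>R ((T p o\<^sub>L E p) o\<^sub>L \<theta>' p X)"
    if p: "p \<in> U" for p X
  proof -
    have "mderiv A E p X = (- t) *\<^sub>R mderiv A \<tau> p X"
      unfolding E_def[abs_def] by (rule mderiv_affine[OF atlas L \<tau>(1) p])
    then have "mderiv A (\<lambda>p. T p o\<^sub>L E p) p X =
        (T p o\<^sub>L ((- t) *\<^sub>R mderiv A \<tau> p X)) + ((t *\<^sub>R (T p o\<^sub>L \<theta> p X)) o\<^sub>L E p)"
      using mderiv_bilinear[OF atlas bounded_bilinear_blinfun_compose T(1) sE p p, of X]
      by (simp add: T(3)[OF p])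
    moreover have "\<theta> p X (E p v) = \<theta> p X v" for v
      using \<theta>_kills[OF p \<tau>_range[OF p]]
      by (simp add: E_def blinfun.diff_left blinfun.diff_right blinfun.scaleR_left
          blinfun.scaleR_right)
    ultimately have "mderiv A (\<lambda>p. T p o\<^sub>L E p) p X v = t *\<^sub>R T p (\<theta>' p X v)" for v
      by (simp add: eq[OF p] blinfun.add_left blinfun.diff_left blinfun.diff_right
          blinfun.minus_left blinfun.minus_right blinfun.scaleR_left blinfun.scaleR_right
          scaleR_diff_right)
    moreover have "E p (\<theta>' p X v) = \<theta>' p X v" for v
      using \<tau>_kills[OF p \<theta>'_range[OF p]]
      by (simp add: E_def blinfun.diff_left blinfun.scaleR_left)
    ultimately show ?thesis by (intro blinfun_eqI) (simp add: blinfun.scaleR_left)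
  qed
  ultimately show ?thesis by (simp add: trivialising_gauge_iff[OF U] E_eq)
qed

end

section \<open>Legendre maps\<close>

lemma subbundleD:
  assumes "subbundle A U r W" "p \<in> U"
  obtains N e where "open N" "p \<in> N" "N \<subseteq> U" "\<And>i. i < r \<Longrightarrow> smooth_map A N (e i)"
    "\<And>q. q \<in> N \<Longrightarrow> W q = span {e i q | i. i < r}"
proof -
  have "\<exists>N e. open N \<and> p \<in> N \<and> N \<subseteq> U \<and> (\<forall>i<r. smooth_map A N (e i)) \<and>
      (\<forall>q\<in>N. W q = span {e i q | i. i < r})"
    using assms by (simp add: subbundle_def)
  then show thesis using that by (elim exE conjE) blast
qed

lemma legendre_isotropic_plane: "legendre_map A U f \<Longrightarrow> p \<in> U \<Longrightarrow> isotropic_plane (f p)"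
  by (simp add: legendre_map_def subbundle_def isotropic_plane_def)

lemma legendre_mderiv_perp:
  assumes "legendre_map A U f" "p \<in> U" "local_section A f p \<sigma>"
  shows "mderiv A \<sigma> p X \<in> perp (f p)"
proof -
  have "mderiv A \<sigma> p X \<in> derived A f p"
    unfolding derived_def using assms(3) by (intro span_base) blast
  then show ?thesis using assms(1,2) unfolding legendre_map_def by blast
qed

context
  fixes A :: "('a::{t2_space,second_countable_topology}) chart set"
  assumes atlas: "smooth_atlas A"
begin

lemma subbundle_image:
  assumes U: "open U" and f: "subbundle A V r f" "U \<subseteq> V"
    and T: "smooth_map A U T" "\<And>p. p \<in> U \<Longrightarrow> orthogonal42 (T p)"
    and F: "\<And>p. p \<in> U \<Longrightarrow> F p = blinfun_apply (T p) ` f p"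
  shows "subbundle A U r F"
  unfolding subbundle_def
proof (intro conjI ballI)
  fix p assume p: "p \<in> U"
  have "subspace (f p)" "dim (f p) = r" using f p by (auto simp: subbundle_def)
  then show "subspace (F p)" "dim (F p) = r"
    using p by (simp_all add: F T dim_orthogonal_image subspace_image_blinfun)
  obtain N e where N: "open N" "p \<in> N" "N \<subseteq> V"
    and e: "\<And>i. i < r \<Longrightarrow> smooth_map A N (e i)" and fe: "\<And>q. q \<in> N \<Longrightarrow> f q = span {e i q | i. i < r}"
    using subbundleD[OF f(1) subsetD[OF f(2) p]] by blast
  have oNU: "open (N \<inter> U)" by (rule open_Int[OF N(1) U])
  have "smooth_map A (N \<inter> U) (\<lambda>q. T q (e i q))" if "i < r" for i
    using e[OF that] T(1) by (intro smooth_map_apply[OF atlas oNU]) (auto intro: smooth_map_subset)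
  moreover have "F q = span {T q (e i q) | i. i < r}" if q: "q \<in> N \<inter> U" for q
  proof -
    have "F q = blinfun_apply (T q) ` span {e i q | i. i < r}" using q F fe by simp
    also have "\<dots> = span (blinfun_apply (T q) ` {e i q | i. i < r})"
      by (rule linear_span_image[symmetric])
        (simp add: blinfun.bounded_linear_right bounded_linear.linear)
    also have "blinfun_apply (T q) ` {e i q | i. i < r} = {T q (e i q) | i. i < r}" by blast
    finally show ?thesis .
  qed
  ultimately show "\<exists>N e. open N \<and> p \<in> N \<and> N \<subseteq> U \<and> (\<forall>i<r. smooth_map A N (e i)) \<and>
      (\<forall>q\<in>N. F q = span {e i q | i. i < r})"
    using oNU N(2) p by (intro exI[of _ "N \<inter> U"] exI[of _ "\<lambda>i q. T q (e i q)"]) auto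
qed

text \<open>If the potential kills \<open>f\<close>, then \<open>d (T\<sigma>) = T d\<sigma>\<close> for sections of \<open>f\<close>, so that
  \<open>T f\<close> inherits the first order conditions on \<open>f\<close>.\<close>

lemma legendre_map_gauge:
  assumes f: "legendre_map A UNIV f" and U: "open U" and triv: "trivialising_gauge A U \<theta> t T"
    and kills: "\<And>p X v. p \<in> U \<Longrightarrow> v \<in> f p \<Longrightarrow> \<theta> p X v = 0"
    and F: "\<And>p. p \<in> U \<Longrightarrow> F p = blinfun_apply (T p) ` f p"
  shows "legendre_map A U F"
proof -
  have T: "smooth_map A U T" "\<And>p. p \<in> U \<Longrightarrow> orthogonal42 (T p)"
    using triv by (auto simp: trivialising_gauge_iff[OF atlas U])
  have sb: "subbundle A U 2 F"
    using f by (intro subbundle_image[OF U _ _ T F]) (auto simp: legendre_map_def)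
  have iso: "isotropic (F p)" if "p \<in> U" for p
    using f that T by (simp add: F legendre_map_def orthogonal_image_isotropic)
  have push: "local_section A F p (\<lambda>q. T q (\<sigma> q)) \<and>
      mderiv A (\<lambda>q. T q (\<sigma> q)) p X = T p (mderiv A \<sigma> p X)"
    if p: "p \<in> U" and \<sigma>: "local_section A f p \<sigma>" for p \<sigma> X
  proof -
    obtain N where N: "open N" "p \<in> N" "smooth_map A N \<sigma>" "\<forall>q\<in>N. \<sigma> q \<in> f q"
      using \<sigma> unfolding local_section_def section_on_def by blast
    have "smooth_map A (N \<inter> U) (\<lambda>q. T q (\<sigma> q))"
      using N U T(1) by (intro smooth_map_apply[OF atlas]) (auto intro: smooth_map_subset)
    then have "local_section A F p (\<lambda>q. T q (\<sigma> q))"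
      unfolding local_section_def section_on_def using N U p F
      by (intro exI[of _ "N \<inter> U"]) auto
    then show ?thesis
      using mderiv_gauge[OF atlas triv U p N(3,2) kills[OF p]] N(2,4) by blast
  qed
  \<comment> \<open>Sections of \<open>T f\<close> are images of sections of \<open>f\<close>, near points of \<open>U\<close>.\<close>
  have pull: "\<exists>\<sigma>. local_section A f p \<sigma> \<and> mderiv A \<sigma>' p X = T p (mderiv A \<sigma> p X)"
    if p: "p \<in> U" and \<sigma>': "local_section A F p \<sigma>'" for p \<sigma>' X
  proof -
    obtain N where N: "open N" "p \<in> N" "smooth_map A N \<sigma>'" "\<forall>q\<in>N. \<sigma>' q \<in> F q"
      using \<sigma>' unfolding local_section_def section_on_def by blast
    define \<sigma> where "\<sigma> q = inv (blinfun_apply (T q)) (\<sigma>' q)" for q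
    have NU: "open (N \<inter> U)" "p \<in> N \<inter> U" using N U p by auto
    have "smooth_map A (N \<inter> U) \<sigma>"
      unfolding \<sigma>_def[abs_def] using N T
      by (intro smooth_map_inv_orthogonal[OF atlas NU(1)]) (auto intro: smooth_map_subset)
    moreover have "\<sigma> q \<in> f q" if "q \<in> N \<inter> U" for q
    proof -
      have "\<sigma>' q \<in> blinfun_apply (T q) ` f q" using N(4) F \<open>q \<in> N \<inter> U\<close> by blast
      then obtain a where "a \<in> f q" "\<sigma>' q = T q a" by blast
      then show ?thesis
        using inj_orthogonal[OF T(2)] \<open>q \<in> N \<inter> U\<close> by (simp add: \<sigma>_def)
    qed
    ultimately have \<sigma>: "local_section A f p \<sigma>"
      unfolding local_section_def section_on_def using NU by blast
    have "T q (\<sigma> q) = \<sigma>' q" if "q \<in> N \<inter> U" for q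
      using bij_orthogonal[OF T(2)] that by (simp add: \<sigma>_def bij_is_surj surj_f_inv_f)
    then have "mderiv A (\<lambda>q. T q (\<sigma> q)) p X = mderiv A \<sigma>' p X"
      using N(3) by (intro mderiv_cong[OF atlas _ NU]) (auto intro: smooth_map_subset)
    then show ?thesis using push[OF p \<sigma>] \<sigma> by auto
  qed
  have "derived A F p \<subseteq> perp (F p)" if p: "p \<in> U" for p
    unfolding derived_def
  proof (intro span_minimal subspace_perp Un_least)
    show "{\<sigma> p |\<sigma>. local_section A F p \<sigma>} \<subseteq> perp (F p)"
      using isotropic_subset_perp[OF iso[OF p]] unfolding local_section_def section_on_def by blast
    show "{mderiv A \<sigma> p X |\<sigma> X. local_section A F p \<sigma>} \<subseteq> perp (F p)"
    proof
      fix v assume "v \<in> {mderiv A \<sigma> p X |\<sigma> X. local_section A F p \<sigma>}"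
      then obtain \<sigma> X where "v = T p (mderiv A \<sigma> p X)" "local_section A f p \<sigma>"
        using pull[OF p] by blast
      then show "v \<in> perp (F p)"
        using legendre_mderiv_perp[OF f] orthogonal_image_perp[OF T(2)[OF p]] F[OF p] by auto
    qed
  qed
  moreover have "immersed A U F"
    unfolding immersed_def
  proof (intro ballI allI impI)
    fix p X assume p: "p \<in> U" and
      *: "\<forall>\<sigma>. local_section A F p \<sigma> \<longrightarrow> mderiv A \<sigma> p X \<in> F p"
    have "mderiv A \<sigma> p X \<in> f p" if "local_section A f p \<sigma>" for \<sigma>
    proof -
      have "mderiv A (\<lambda>q. T q (\<sigma> q)) p X \<in> F p"
        using push[OF p that, THEN conjunct1] * by blast
      then have "T p (mderiv A \<sigma> p X) \<in> blinfun_apply (T p) ` f p"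
        by (simp only: push[OF p that, THEN conjunct2] F[OF p])
      then show ?thesis by (simp add: inj_image_mem_iff[OF inj_orthogonal[OF T(2)[OF p]]])
    qed
    moreover have "immersed A UNIV f" using f by (simp add: legendre_map_def)
    ultimately show "X = 0" unfolding immersed_def by blast
  qed
  ultimately show ?thesis using sb iso by (simp add: legendre_map_def)
qed

text \<open>This is tensoriality of \<open>\<sigma> \<mapsto> d\<^sub>X \<sigma> mod f\<close>: where \<open>\<mu>\<close> vanishes, its derivative is both
  orthogonal to \<open>f\<close> and lightlike.\<close>

lemma legendre_mderiv_at_zero:
  assumes f: "legendre_map A U f" and p: "p \<in> U" and \<mu>: "local_section A f p \<mu>" "\<mu> p = 0"
    and U: "open U"
  shows "mderiv A \<mu> p X \<in> f p"
proof -
  obtain N where N: "open N" "p \<in> N" "smooth_map A N \<mu>" "\<forall>q\<in>N. \<mu> q \<in> f q"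
    using \<mu>(1) unfolding local_section_def section_on_def by blast
  have "lform (\<mu> q) (\<mu> q) = 0" if "q \<in> N \<inter> U" for q
    using N(4) f that by (auto simp: legendre_map_def isotropic_def)
  then have "lform (mderiv A \<mu> p X) (mderiv A \<mu> p X) = 0"
    using N p U \<mu>(2)
    by (intro mderiv_lightlike_at_zero[OF atlas, of "N \<inter> U"]) (auto intro: smooth_map_subset)
  then show ?thesis
    using mem_isotropic_plane[OF legendre_isotropic_plane[OF f p] legendre_mderiv_perp[OF f p \<mu>(1)]]
    by simp
qed

text \<open>By tensoriality, it is enough to test a curvature sphere on one of its sections.\<close>

lemma curvature_sphere_span:
  assumes f: "legendre_map A UNIV f" and \<sigma>: "local_section A f p \<sigma>" "\<sigma> p \<noteq> 0"
    and X: "X \<noteq> 0" "mderiv A \<sigma> p X \<in> f p"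
  shows "curvature_sphere A f p (span {\<sigma> p})"
proof -
  have sf: "subspace (f p)" using legendre_isotropic_plane[OF f] by (simp add: isotropic_plane_def)
  obtain N where N: "open N" "p \<in> N" "smooth_map A N \<sigma>" "\<forall>q\<in>N. \<sigma> q \<in> f q"
    using \<sigma>(1) unfolding local_section_def section_on_def by blast
  have "mderiv A \<mu> p Y \<in> f p"
    if Y: "Y \<in> span {X}" and \<mu>: "local_section A f p \<mu>" "\<mu> p \<in> span {\<sigma> p}" for Y \<mu>
  proof -
    obtain c where c: "Y = c *\<^sub>R X" using Y by (auto simp: span_singleton)
    obtain a where a: "\<mu> p = a *\<^sub>R \<sigma> p" using \<mu>(2) by (auto simp: span_singleton)
    obtain M where M: "open M" "p \<in> M" "smooth_map A M \<mu>" "\<forall>q\<in>M. \<mu> q \<in> f q"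
      using \<mu>(1) unfolding local_section_def section_on_def by blast
    have L: "bounded_linear (\<lambda>v::r42. (- a) *\<^sub>R v)" by (rule bounded_linear_scaleR_right)
    let ?\<nu> = "\<lambda>q. \<mu> q + (- a) *\<^sub>R \<sigma> q"
    have "smooth_map A (M \<inter> N) ?\<nu>"
      using M N
      by (intro smooth_map_add[OF atlas] smooth_map_linear[OF atlas L])
        (auto intro: smooth_map_subset)
    moreover have "?\<nu> q \<in> f q" if "q \<in> M \<inter> N" for q
      using M(4) N(4) that legendre_isotropic_plane[OF f, of q]
      by (intro subspace_add subspace_scale) (auto simp: isotropic_plane_def)
    ultimately have "local_section A f p ?\<nu>"
      unfolding local_section_def section_on_def using M(1,2) N(1,2)
      by (intro exI[of _ "M \<inter> N"]) auto
    then have "mderiv A ?\<nu> p Y \<in> f p"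
      using a by (intro legendre_mderiv_at_zero[OF f]) auto
    moreover have "mderiv A ?\<nu> p Y = mderiv A \<mu> p Y + (- a) *\<^sub>R mderiv A \<sigma> p Y"
      using mderiv_add[OF atlas M(3) smooth_map_linear[OF atlas L N(1,3)] M(2) N(2)]
        mderiv_linear[OF atlas L N(3,2)] by simp
    moreover have "mderiv A \<sigma> p Y = c *\<^sub>R mderiv A \<sigma> p X"
      unfolding c by (rule linear_scale[OF linear_mderiv[OF atlas N(3,2)]])
    ultimately have "mderiv A \<mu> p Y = mderiv A ?\<nu> p Y + (a * c) *\<^sub>R mderiv A \<sigma> p X" by simp
    then show ?thesis
      using \<open>mderiv A ?\<nu> p Y \<in> f p\<close> X(2) by (simp only:) (intro subspace_add subspace_scale sf)
  qed
  moreover have "span {\<sigma> p} \<subseteq> f p" using N sf by (intro span_minimal) auto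
  moreover have "dim (span {\<sigma> p}) = 1" using \<sigma>(2) by (simp add: dim_insert)
  moreover have "span {X} \<noteq> {0}" using X(1) span_base[of X "{X}"] by auto
  ultimately show ?thesis
    unfolding curvature_sphere_def by (intro conjI exI[of _ "span {X}"]) auto
qed

text \<open>For isotropic planes, \<open>G \<subseteq> F\<^sup>\<bottom>\<close> means \<open>G = F\<close>. Thus coincidence of two
  smooth families of isotropic planes is a closed condition.\<close>

lemma open_not_subset_perp:
  assumes U: "open U" and F: "subbundle A U r F" and G: "subbundle A U r' G"
  shows "open {p \<in> U. \<not> G p \<subseteq> perp (F p)}"
proof (subst open_subopen, rule ballI)
  fix p assume "p \<in> {p \<in> U. \<not> G p \<subseteq> perp (F p)}"
  then have p: "p \<in> U" "\<not> G p \<subseteq> perp (F p)" by auto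
  obtain N e where N: "open N" "p \<in> N" "N \<subseteq> U" and e: "\<And>i. i < r \<Longrightarrow> smooth_map A N (e i)"
    and Fe: "\<And>q. q \<in> N \<Longrightarrow> F q = span {e i q | i. i < r}"
    using subbundleD[OF F p(1)] by blast
  obtain M d where M: "open M" "p \<in> M" "M \<subseteq> U" and d: "\<And>i. i < r' \<Longrightarrow> smooth_map A M (d i)"
    and Gd: "\<And>q. q \<in> M \<Longrightarrow> G q = span {d i q | i. i < r'}"
    using subbundleD[OF G p(1)] by blast
  have "\<exists>i<r. \<exists>j<r'. lform (e i p) (d j p) \<noteq> 0"
  proof (rule ccontr)
    assume "\<not> ?thesis"
    then have 0: "lform (e i p) (d j p) = 0" if "i < r" "j < r'" for i j using that by blast
    have "d j p \<in> perp (F p)" if "j < r'" for j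
    proof -
      have "span {e i p | i. i < r} \<subseteq> perp {d j p}"
        using 0 that by (intro span_minimal subspace_perp) (auto simp: perp_def)
      then show ?thesis using Fe[OF N(2)] by (auto simp: perp_def lform_commute[of "d j p"])
    qed
    then have "span {d j p | j. j < r'} \<subseteq> perp (F p)"
      by (intro span_minimal subspace_perp) blast
    then show False using p(2) Gd[OF M(2)] by simp
  qed
  then obtain i j where ij: "i < r" "j < r'" "lform (e i p) (d j p) \<noteq> 0" by blast
  let ?h = "\<lambda>q. lform (e i q) (d j q)"
  have oNM: "open (N \<inter> M)" by (rule open_Int[OF N(1) M(1)])
  have "smooth_map A (N \<inter> M) ?h"
    using e[OF ij(1)] d[OF ij(2)]
    by (intro smooth_map_bilinear[OF atlas bounded_bilinear_lform oNM]) (auto intro: smooth_map_subset)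
  then have "continuous_on (N \<inter> M) ?h" by (rule smooth_map_imp_continuous_on[OF atlas oNM])
  then have "open ((N \<inter> M) \<inter> ?h -` (- {0}))"
    by (rule continuous_open_preimage[OF _ oNM]) auto
  moreover have "\<not> G q \<subseteq> perp (F q)" if "q \<in> N" "q \<in> M" "?h q \<noteq> 0" for q
  proof -
    have "e i q \<in> F q" "d j q \<in> G q"
      using ij that by (auto simp: Fe Gd intro!: span_base)
    then show ?thesis using that(3) lform_commute[of "e i q" "d j q"] by (auto simp: perp_def)
  qed
  ultimately show "\<exists>T. open T \<and> p \<in> T \<and> T \<subseteq> {p \<in> U. \<not> G p \<subseteq> perp (F p)}"
    using N M ij by (intro exI[of _ "(N \<inter> M) \<inter> ?h -` (- {0})"]) auto
qed

text \<open>Pointwise there are two candidates for a Legendre lift, by the signature of the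
  normal bundle of the surface. They never coincide, so a connected surface has to stay with one
  of them.\<close>

lemma legendre_lifts_of_surface:
  assumes U: "open U" "connected U" and F: "legendre_map A U F" and G: "legendre_map A U G"
    and s: "smooth_map A U s" "\<And>p. p \<in> U \<Longrightarrow> s p \<noteq> 0" "\<And>p. p \<in> U \<Longrightarrow> s p \<in> F p"
      "\<And>p. p \<in> U \<Longrightarrow> s p \<in> G p"
    and inj: "\<And>p X. p \<in> U \<Longrightarrow> mderiv A s p X \<in> F p \<Longrightarrow> X = 0"
    and k: "lform k k \<noteq> 0" "\<And>p. p \<in> U \<Longrightarrow> lform (s p) k = 0"
  shows "(\<forall>p\<in>U. G p = F p) \<or> (\<forall>p\<in>U. G p = blinfun_apply (reflection k) ` F p)"
proof -
  let ?R = "\<lambda>p. blinfun_apply (reflection k) ` F p"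
  have oR: "orthogonal42 (reflection k)" by (rule orthogonal_reflection[OF k(1)])
  have surf: "isotropic_plane (F p)" "isotropic_plane (G p)" "linear (mderiv A s p)"
    "\<And>X. mderiv A s p X \<in> perp (F p)" "\<And>X. mderiv A s p X \<in> perp (G p)"
    "\<And>X. lform k (mderiv A s p X) = 0" if p: "p \<in> U" for p
  proof -
    show "isotropic_plane (F p)" "isotropic_plane (G p)"
      using legendre_isotropic_plane F G p by auto
    show "linear (mderiv A s p)" by (rule linear_mderiv[OF atlas s(1) p])
    have loc: "local_section A F p s" "local_section A G p s"
      unfolding local_section_def section_on_def using U(1) p s by blast+
    show "mderiv A s p X \<in> perp (F p)" for X by (rule legendre_mderiv_perp[OF F p loc(1)])
    show "mderiv A s p X \<in> perp (G p)" for X by (rule legendre_mderiv_perp[OF G p loc(2)])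
    show "lform k (mderiv A s p X) = 0" for X
      using lform_mderiv_eq_0[OF atlas s(1) U(1) p k(2)] by (simp add: lform_commute[of k "mderiv A s p X"])
  qed
  have dich: "G p = F p \<or> G p = ?R p" if p: "p \<in> U" for p
    using isotropic_planes_over_surface_element[OF surf(1)[OF p] surf(3,4)[OF p] inj[OF p] k(1)
        surf(6)[OF p] s(3)[OF p] s(2)[OF p] k(2)[OF p] surf(2)[OF p] s(4)[OF p] surf(5)[OF p]] .
  have neq: "F p \<noteq> ?R p" if p: "p \<in> U" for p
  proof
    assume eq: "F p = ?R p"
    obtain b where b: "b \<in> F p" "lform b k \<noteq> 0"
      using transverse_plane_not_orthogonal[OF surf(1)[OF p] surf(3,4)[OF p] inj[OF p] k(1)
          surf(6)[OF p]] by blast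
    then have "reflection k b \<in> F p" using eq by blast
    then have "b - reflection k b \<in> F p"
      using b(1) surf(1)[OF p] by (intro subspace_diff) (auto simp: isotropic_plane_def)
    moreover have "b - reflection k b = (2 * lform b k / lform k k) *\<^sub>R k"
      by (simp add: reflection_apply)
    ultimately have "(2 * lform b k / lform k k) *\<^sub>R k \<in> F p" by simp
    then have "lform b ((2 * lform b k / lform k k) *\<^sub>R k) = 0"
      using surf(1)[OF p] b(1) unfolding isotropic_plane_def isotropic_def by blast
    then show False using b(2) k(1) by (simp add: lform.scaleR_right)
  qed
  have sF: "subbundle A U 2 F" and sG: "subbundle A U 2 G"
    using F G by (auto simp: legendre_map_def)
  have sR: "subbundle A U 2 ?R"
    by (rule subbundle_image[OF U(1) sF order_refl smooth_map_const[OF atlas] oR refl])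
  let ?V = "{p \<in> U. \<not> G p \<subseteq> perp (F p)}" and ?W = "{p \<in> U. \<not> G p \<subseteq> perp (?R p)}"
  have V: "p \<in> ?V \<longleftrightarrow> G p \<noteq> F p" if p: "p \<in> U" for p
    using isotropic_planes_eq_iff[OF surf(1,2)[OF p]] p by simp
  have W: "p \<in> ?W \<longleftrightarrow> G p \<noteq> ?R p" if p: "p \<in> U" for p
    using isotropic_planes_eq_iff[OF isotropic_plane_image[OF oR surf(1)[OF p]] surf(2)[OF p]] p
    by simp
  have "open ?V" "open ?W"
    using open_not_subset_perp[OF U(1)] sF sG sR by auto
  moreover have "?V \<inter> ?W \<inter> U = {}" using V W dich by blast
  moreover have "U \<subseteq> ?V \<union> ?W" using V W neq by (metis (no_types, lifting) UnCI subsetI)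
  ultimately have "?V \<inter> U = {} \<or> ?W \<inter> U = {}" by (rule connectedD[OF U(2)])
  then show ?thesis using V W by blast
qed

end

section \<open>The real isothermic sphere congruence\<close>

lemma line_eq_span:
  fixes W :: "'v::euclidean_space set"
  assumes "subspace W" "dim W = 1" "a \<in> W" "a \<noteq> 0"
  shows "W = span {a}"
proof (rule subspace_dim_equal[symmetric])
  show "span {a} \<subseteq> W" using assms by (intro span_minimal) auto
  have "dim (span {a}) = 1" using assms(4) by (simp add: dim_insert)
  then show "dim W \<le> dim (span {a})" using assms(2) by simp
qed (use assms in auto)

text \<open>For \<open>\<epsilon> = \<i>\<close> the sphere is the complex line of \<open>\<sigma>1 + \<i> \<sigma>2\<close> with \<open>\<sigma>1\<close>, \<open>\<sigma>2\<close>
  independent. It is not invariant under complex conjugation, so it is not the complexification of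
  a real line.\<close>

lemma isothermic_sphere_real:
  assumes C: "complexify W = isothermic_sphere \<epsilon> \<sigma>1 \<sigma>2 p" and \<epsilon>: "\<epsilon> \<in> {1, \<i>}"
    and nz: "\<sigma>1 p \<noteq> 0" and ind: "\<sigma>2 p \<notin> span {\<sigma>1 p}"
  shows "W = span {\<sigma>1 p + \<sigma>2 p}"
proof -
  have mem: "(u, v) \<in> complexify W \<longleftrightarrow> u \<in> W \<and> v \<in> W" for u v by (simp add: complexify_def)
  have "\<epsilon> \<noteq> \<i>"
  proof
    assume "\<epsilon> = \<i>"
    then have sph: "isothermic_sphere \<epsilon> \<sigma>1 \<sigma>2 p = range (\<lambda>c. cscale c (\<sigma>1 p, \<sigma>2 p))"
      by (simp add: isothermic_sphere_def cembed_def cscale_def)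
    have "cscale 1 (\<sigma>1 p, \<sigma>2 p) \<in> complexify W" unfolding C sph by (rule rangeI)
    then have "(\<sigma>1 p, \<sigma>1 p) \<in> complexify W" by (simp add: mem cscale_def)
    then obtain c where c: "\<sigma>1 p = Re c *\<^sub>R \<sigma>1 p - Im c *\<^sub>R \<sigma>2 p"
      "\<sigma>1 p = Re c *\<^sub>R \<sigma>2 p + Im c *\<^sub>R \<sigma>1 p"
      unfolding C sph by (auto simp: cscale_def)
    have "Im c *\<^sub>R \<sigma>2 p = (Re c - 1) *\<^sub>R \<sigma>1 p"
      using c(1) by (simp add: algebra_simps)
    moreover have "Re c *\<^sub>R \<sigma>2 p = (1 - Im c) *\<^sub>R \<sigma>1 p"
      using c(2) by (simp add: algebra_simps)
    moreover have "r = 0" if "r *\<^sub>R \<sigma>2 p = x *\<^sub>R \<sigma>1 p" for r x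
    proof (rule ccontr)
      assume "r \<noteq> 0"
      then have "\<sigma>2 p = (1 / r) *\<^sub>R (r *\<^sub>R \<sigma>2 p)" by simp
      also have "\<dots> = (x / r) *\<^sub>R \<sigma>1 p" by (simp add: that)
      finally have "\<sigma>2 p \<in> span {\<sigma>1 p}" unfolding span_singleton by (rule range_eqI)
      then show False using ind by simp
    qed
    ultimately have "Re c = 0" "Im c = 0" by blast+
    then show False using c(1) nz by simp
  qed
  then have "\<epsilon> = 1" using \<epsilon> by simp
  then have sph: "isothermic_sphere \<epsilon> \<sigma>1 \<sigma>2 p =
      range (\<lambda>c. (Re c *\<^sub>R (\<sigma>1 p + \<sigma>2 p), Im c *\<^sub>R (\<sigma>1 p + \<sigma>2 p)))"
    by (simp add: isothermic_sphere_def cembed_def cscale_def)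
  show ?thesis
  proof (intro equalityI subsetI)
    fix v assume "v \<in> W"
    then have "(v, v) \<in> complexify W" by (simp add: mem)
    then show "v \<in> span {\<sigma>1 p + \<sigma>2 p}" unfolding C sph by (auto simp: span_singleton)
  next
    fix v assume "v \<in> span {\<sigma>1 p + \<sigma>2 p}"
    then obtain r where r: "v = r *\<^sub>R (\<sigma>1 p + \<sigma>2 p)" by (auto simp: span_singleton)
    have "(v, v) \<in> complexify W"
      unfolding C sph by (rule image_eqI[of _ _ "Complex r r"]) (simp_all add: r)
    then show "v \<in> W" by (simp add: mem)
  qed
qed

section \<open>Calapso transforms and Legendre lifts\<close>

context
  fixes A :: "('a::{t2_space,second_countable_topology}) chart set"
    and f \<Lambda> :: "'a \<Rightarrow> r42 set" and \<theta> \<theta>' :: "'a \<Rightarrow> real^2 \<Rightarrow> endo42" and \<tau> :: "'a \<Rightarrow> endo42"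
    and k :: r42 and U :: "'a set"
  assumes atlas: "smooth_atlas A"
    and f: "legendre_map A UNIV f"
    and \<theta>: "\<And>p X. \<theta> p X \<in> wedge_space (f p) (perp (f p))"
    and \<theta>': "\<And>p X. \<theta>' p X \<in> wedge_space (f p) (perp (f p))"
    and \<tau>: "smooth_map A UNIV \<tau>" "\<And>p. \<tau> p \<in> wedge_space (f p) (f p)"
    and eq: "\<And>p X. \<theta>' p X = \<theta> p X - mderiv A \<tau> p X"
    and \<Lambda>f: "\<And>p. \<Lambda> p \<subseteq> f p"
    and k: "lform k k \<noteq> 0" "\<And>p X. \<theta>' p X k = 0"
    and U: "open U" "connected U"
begin

lemma isotropic_plane_f: "isotropic_plane (f p)"
  using legendre_isotropic_plane[OF f] by simp

lemma subspace_f: "subspace (f p)" and isotropic_f: "isotropic (f p)"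
  using isotropic_plane_f by (auto simp: isotropic_plane_def)

lemma potential_kills_f:
  assumes "\<omega> \<in> wedge_space (f p) (perp (f p))" "v \<in> f p"
  shows "blinfun_apply \<omega> v = 0"
proof (rule wedge_space_kills[OF assms(1)])
  show "v \<in> perp (f p)" using isotropic_subset_perp[OF isotropic_f] assms(2) by blast
  show "v \<in> perp (perp (f p))"
    using assms(2) by (simp add: perp_def) (metis lform_commute)
qed

text \<open>A gauge transformation that trivialises \<open>d + t\<theta>'\<close> takes \<open>k\<close> to a constant vector,
  because \<open>k\<close> is parallel for that connection. A Lie sphere transformation brings the
  vector back to \<open>k\<close>, as the normalisation of Calapso transforms of \<open>\<Lambda>\<close> demands.\<close>

lemma calapso_transform_is_legendre_lift:
  assumes "calapso_transform A U f \<theta> t F"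
  shows "\<exists>g L. orthogonal42 g \<and> isothermic_calapso_transform A U k \<Lambda> \<theta>' t L \<and>
    legendre_lift A U L (\<lambda>p. blinfun_apply g ` F p)"
proof -
  obtain T where T: "trivialising_gauge A U \<theta> t T" "\<And>p. p \<in> U \<Longrightarrow> F p = blinfun_apply (T p) ` f p"
    using assms unfolding calapso_transform_def by blast
  \<comment> \<open>\<open>S\<close> trivialises \<open>d + t\<theta>'\<close> and agrees with \<open>T\<close> on \<open>f\<close>.\<close>
  define S where "S p = T p o\<^sub>L (id_blinfun - t *\<^sub>R \<tau> p)" for p
  have S: "trivialising_gauge A U \<theta>' t S"
    unfolding S_def[abs_def]
    by (rule trivialising_gauge_orbit[OF atlas U(1) T(1) subspace_f isotropic_f \<theta> \<theta>'
          smooth_map_subset[OF \<tau>(1) subset_UNIV] \<tau>(2) eq])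
  have Sf: "blinfun_apply (S p) ` f p = blinfun_apply (T p) ` f p" for p
    unfolding S_def by (rule gauge_orbit_image[OF isotropic_f \<tau>(2)])
  have S': "smooth_map A U S" "\<And>p. p \<in> U \<Longrightarrow> orthogonal42 (S p)"
    "\<And>p X. p \<in> U \<Longrightarrow> mderiv A S p X = t *\<^sub>R (S p o\<^sub>L \<theta>' p X)"
    using S by (auto simp: trivialising_gauge_iff[OF atlas U(1)])
  have "\<exists>k'. lform k' k' = lform k k \<and> (\<forall>p\<in>U. S p k = k')"
  proof (cases "U = {}")
    case False
    then obtain p0 where p0: "p0 \<in> U" by blast
    have sk: "smooth_map A U (\<lambda>p. S p k)"
      by (intro smooth_map_apply[OF atlas U(1) S'(1)] smooth_map_const[OF atlas])
    have "mderiv A (\<lambda>p. S p k) p X = 0" if p: "p \<in> U" for p X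
      using mderiv_linear[OF atlas blinfun.bounded_linear_left S'(1) p, of k X]
      by (simp add: S'(3)[OF p] blinfun.scaleR_left k(2))
    then have "\<forall>p\<in>U. S p k = S p0 k"
      using mderiv_zero_imp_constant[OF atlas U sk _ p0] by blast
    moreover have "lform (S p0 k) (S p0 k) = lform k k"
      using S'(2)[OF p0] by (simp add: orthogonal42_def)
    ultimately show ?thesis by blast
  qed auto
  then obtain k' where k': "lform k' k' = lform k k" "\<And>p. p \<in> U \<Longrightarrow> S p k = k'" by blast
  obtain g where g: "orthogonal42 g" "g k' = k" using ex_orthogonal_map_vector[OF k(1) k'(1)] by blast
  define L where "L p = blinfun_apply (g o\<^sub>L S p) ` \<Lambda> p" for p
  have "isothermic_calapso_transform A U k \<Lambda> \<theta>' t L"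
    unfolding isothermic_calapso_transform_def
  proof (intro exI[of _ "\<lambda>p. g o\<^sub>L S p"] conjI ballI)
    show "trivialising_gauge A U \<theta>' t (\<lambda>p. g o\<^sub>L S p)"
      by (rule trivialising_gauge_compose[OF atlas S U(1) g(1)])
  qed (simp_all add: L_def k' g)
  moreover have "legendre_map A U (\<lambda>p. blinfun_apply g ` F p)"
  proof (rule legendre_map_gauge[OF atlas f U(1)])
    show "trivialising_gauge A U \<theta> t (\<lambda>p. g o\<^sub>L T p)"
      by (rule trivialising_gauge_compose[OF atlas T(1) U(1) g(1)])
    show "blinfun_apply g ` F p = blinfun_apply (g o\<^sub>L T p) ` f p" if "p \<in> U" for p
      using T(2)[OF that] by (simp add: image_image)
  qed (rule potential_kills_f[OF \<theta>])
  moreover have "L p \<subseteq> blinfun_apply g ` F p" if "p \<in> U" for p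
  proof -
    have "L p = blinfun_apply g ` blinfun_apply (S p) ` \<Lambda> p" by (simp add: L_def image_image)
    also have "\<dots> \<subseteq> blinfun_apply g ` F p"
      unfolding T(2)[OF that] Sf[symmetric] by (intro image_mono \<Lambda>f)
    finally show ?thesis .
  qed
  ultimately show ?thesis using g(1) unfolding legendre_lift_def by blast
qed

text \<open>The transform of \<open>f\<close> by the gauge transformation that defines \<open>L\<close> is one Legendre lift, and
  the reflection in \<open>k\<close> is the Lie sphere transformation that gives the other.\<close>

lemma legendre_lift_is_calapso_transform:
  assumes s: "smooth_map A UNIV s" "\<And>p. s p \<in> \<Lambda> p" "\<And>p. s p \<noteq> 0" "\<And>p. lform (s p) k = 0"
    and inj: "\<And>p X. mderiv A s p X \<in> f p \<Longrightarrow> X = 0"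
    and L: "isothermic_calapso_transform A U k \<Lambda> \<theta>' t L" and G: "legendre_lift A U L G"
  shows "\<exists>g F. orthogonal42 g \<and> calapso_transform A U f \<theta> t F \<and>
    (\<forall>p\<in>U. G p = blinfun_apply g ` F p)"
proof -
  obtain S where S: "trivialising_gauge A U \<theta>' t S" "\<And>p. p \<in> U \<Longrightarrow> S p k = k"
    "\<And>p. p \<in> U \<Longrightarrow> L p = blinfun_apply (S p) ` \<Lambda> p"
    using L unfolding isothermic_calapso_transform_def by blast
  have S': "smooth_map A U S" "\<And>p. p \<in> U \<Longrightarrow> orthogonal42 (S p)"
    using S(1) by (auto simp: trivialising_gauge_iff[OF atlas U(1)])
  have sf: "s p \<in> f p" for p using s(2) \<Lambda>f by blast
  define F where "F p = blinfun_apply (S p) ` f p" for p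
  have m: "bounded_linear (\<lambda>h::endo42. - h)" by (rule bounded_linear_minus[OF bounded_linear_ident])
  have "calapso_transform A U f \<theta> t F"
    unfolding calapso_transform_def
  proof (intro exI conjI ballI)
    have \<tau>': "- \<tau> p \<in> wedge_space (f p) (f p)" for p
      using \<tau>(2) unfolding wedge_space_def by (rule span_neg)
    have eq': "\<theta> p X = \<theta>' p X - mderiv A (\<lambda>q. - \<tau> q) p X" for p X
      using mderiv_linear[OF atlas m \<tau>(1), of p X] by (simp add: eq)
    show "trivialising_gauge A U \<theta> t (\<lambda>p. S p o\<^sub>L (id_blinfun - t *\<^sub>R (- \<tau> p)))"
      by (rule trivialising_gauge_orbit[OF atlas U(1) S(1) subspace_f isotropic_f \<theta>' \<theta>
            smooth_map_subset[OF smooth_map_linear[OF atlas m open_UNIV \<tau>(1)] subset_UNIV] \<tau>' eq'])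
    show "F p = blinfun_apply (S p o\<^sub>L (id_blinfun - t *\<^sub>R (- \<tau> p))) ` f p" for p
      unfolding F_def by (rule gauge_orbit_image[OF isotropic_f \<tau>', symmetric])
  qed
  moreover have "(\<forall>p\<in>U. G p = F p) \<or> (\<forall>p\<in>U. G p = blinfun_apply (reflection k) ` F p)"
  proof (rule legendre_lifts_of_surface[OF atlas U])
    show "legendre_map A U F"
      by (rule legendre_map_gauge[OF atlas f U(1) S(1) potential_kills_f[OF \<theta>'] F_def])
    show "legendre_map A U G" using G by (simp add: legendre_lift_def)
    show "smooth_map A U (\<lambda>p. S p (s p))"
      by (rule smooth_map_apply[OF atlas U(1) S'(1) smooth_map_subset[OF s(1) subset_UNIV]])
    show "lform k k \<noteq> 0" by (rule k(1))
    fix p assume p: "p \<in> U"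
    show "S p (s p) \<noteq> 0"
      using inj_orthogonal[OF S'(2)[OF p]] s(3)[of p] injD[of "blinfun_apply (S p)" "s p" 0]
      by auto
    show "S p (s p) \<in> F p" unfolding F_def by (intro imageI sf)
    have "S p (s p) \<in> L p" unfolding S(3)[OF p] by (intro imageI s(2))
    then show "S p (s p) \<in> G p" using G p by (auto simp: legendre_lift_def)
    show "lform (S p (s p)) k = 0"
      using S'(2)[OF p] S(2)[OF p] s(4)[of p] unfolding orthogonal42_def by metis
    fix X assume "mderiv A (\<lambda>p. S p (s p)) p X \<in> F p"
    moreover have "mderiv A (\<lambda>p. S p (s p)) p X = S p (mderiv A s p X)"
      by (rule mderiv_gauge[OF atlas S(1) U(1) p s(1) UNIV_I potential_kills_f[OF \<theta>' sf]])
    ultimately show "X = 0"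
      by (intro inj) (simp add: F_def inj_image_mem_iff[OF inj_orthogonal[OF S'(2)[OF p]]])
  qed
  moreover have "F p = blinfun_apply id_blinfun ` F p" for p by simp
  ultimately show ?thesis
    using orthogonal_id orthogonal_reflection[OF k(1)] by metis
qed

end

theorem theorem5p4:
  fixes A :: "('a::{t2_space,second_countable_topology}) chart set"
    and f s1 s2 \<Lambda> :: "'a \<Rightarrow> r42 set"
    and \<eta> \<eta>p :: "'a \<Rightarrow> real^2 \<Rightarrow> endo42"
    and \<sigma>1 \<sigma>2 :: "'a \<Rightarrow> r42"
    and \<sigma>p \<sigma>m :: "'a \<Rightarrow> r42 \<times> r42"
    and \<epsilon> :: complex
    and k :: r42
    and t :: real
    and U :: "'a set"
  assumes "smooth_atlas A"
    and "omega_surface A f \<eta>"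
    and "umbilic_free A f s1 s2"
    and "normalised_lifts A f \<eta> s1 s2 \<sigma>1 \<sigma>2 \<epsilon>"
    and "christoffel_dual_lifts A f \<eta>
           (isothermic_sphere \<epsilon> \<sigma>1 \<sigma>2) (isothermic_sphere (- \<epsilon>) \<sigma>1 \<sigma>2) \<sigma>p \<sigma>m"
    and "k \<noteq> 0" and "k \<notin> lightcone"
    and "\<And>p. complexify (\<Lambda> p) = isothermic_sphere \<epsilon> \<sigma>1 \<sigma>2 p"
    and "\<And>p X. cembed (\<eta>p p X) = cwedge (\<sigma>p p) (mderiv A \<sigma>m p X)"
    and "isothermic_surface A k \<Lambda> \<eta>p"
    and "open U" and "connected U"
  shows "(\<forall>F. calapso_transform A U f \<eta> t F \<longrightarrow>
           (\<exists>g L. orthogonal42 g \<and> isothermic_calapso_transform A U k \<Lambda> \<eta>p t L \<and>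
              legendre_lift A U L (\<lambda>p. blinfun_apply g ` F p))) \<and>
         (\<forall>L G. isothermic_calapso_transform A U k \<Lambda> \<eta>p t L \<and> legendre_lift A U L G \<longrightarrow>
           (\<exists>g F. orthogonal42 g \<and> calapso_transform A U f \<eta> t F \<and>
              (\<forall>p\<in>U. G p = blinfun_apply g ` F p)))"
proof -
  note atlas = assms(1)
  have f: "legendre_map A UNIV f" and \<eta>: "\<And>p X. \<eta> p X \<in> wedge_space (f p) (perp (f p))"
    using assms(2) by (auto simp: omega_surface_def gauge_potential_def)
  have sub1: "subbundle A UNIV 1 s1" and sub2: "subbundle A UNIV 1 s2" and s12: "\<And>p. s1 p \<noteq> s2 p"
    and cs: "\<And>p. {l. curvature_sphere A f p l} = {s1 p, s2 p}"
    using assms(3) by (auto simp: umbilic_free_def)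
  have \<sigma>: "smooth_map A UNIV \<sigma>1" "smooth_map A UNIV \<sigma>2" "\<And>p. \<sigma>1 p \<in> s1 p" "\<And>p. \<sigma>2 p \<in> s2 p"
    "\<And>p. \<sigma>1 p \<noteq> 0" "\<And>p. \<sigma>2 p \<noteq> 0" and \<epsilon>: "\<epsilon> \<in> {1, \<i>}"
    using assms(4) by (auto simp: normalised_lifts_def lift_on_def section_on_def)
  have k: "lform k k \<noteq> 0" using assms(7) by (simp add: lightcone_def)
  have iso: "\<Lambda> p \<subseteq> perp {k}" "\<eta>p p X \<in> wedge_space (\<Lambda> p) (derived A \<Lambda> p)" for p X
    using assms(10) by (auto simp: isothermic_surface_def)
  have span1: "s1 p = span {\<sigma>1 p}" for p
    using sub1 \<sigma> by (intro line_eq_span) (auto simp: subbundle_def)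
  have span2: "s2 p = span {\<sigma>2 p}" for p
    using sub2 \<sigma> by (intro line_eq_span) (auto simp: subbundle_def)
  have ind2: "\<sigma>2 p \<notin> s1 p" for p
  proof
    assume *: "\<sigma>2 p \<in> s1 p"
    have "s1 p = span {\<sigma>2 p}"
      using sub1 * \<sigma>(6) by (intro line_eq_span) (auto simp: subbundle_def)
    then show False using s12[of p] span2 by simp
  qed
  have ind1: "\<sigma>1 p \<notin> s2 p" for p
  proof
    assume *: "\<sigma>1 p \<in> s2 p"
    have "s2 p = span {\<sigma>1 p}"
      using sub2 * \<sigma>(5) by (intro line_eq_span) (auto simp: subbundle_def)
    then show False using s12[of p] span1 by simp
  qed
  have s1f: "s1 p \<subseteq> f p" and s2f: "s2 p \<subseteq> f p" for p
  proof -
    have "curvature_sphere A f p (s1 p)" "curvature_sphere A f p (s2 p)"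
      using cs[of p] by auto
    then show "s1 p \<subseteq> f p" "s2 p \<subseteq> f p" by (auto simp: curvature_sphere_def)
  qed
  define s where "s p = \<sigma>1 p + \<sigma>2 p" for p
  have \<Lambda>: "\<Lambda> p = span {s p}" for p
    unfolding s_def using ind2[of p] span1[of p]
    by (intro isothermic_sphere_real[OF assms(8) \<epsilon> \<sigma>(5)]) simp
  have s: "smooth_map A UNIV s"
    unfolding s_def[abs_def] by (rule smooth_map_add[OF atlas open_UNIV \<sigma>(1,2)])
  have ss1: "s p \<notin> s1 p" for p
  proof
    assume "s p \<in> s1 p"
    then have "s p - \<sigma>1 p \<in> s1 p"
      using \<sigma>(3)[of p] unfolding span1 by (rule span_diff)
    then show False using ind2[of p] by (simp add: s_def)
  qed
  have ss2: "s p \<notin> s2 p" for p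
  proof
    assume "s p \<in> s2 p"
    then have "s p - \<sigma>2 p \<in> s2 p"
      using \<sigma>(4)[of p] unfolding span2 by (rule span_diff)
    then show False using ind1[of p] by (simp add: s_def)
  qed
  have sf: "s p \<in> f p" for p
    using legendre_isotropic_plane[OF f, of p] s1f[of p] s2f[of p] \<sigma>(3,4)[of p]
    unfolding s_def by (intro subspace_add) (auto simp: isotropic_plane_def)
  have \<Lambda>f: "\<Lambda> p \<subseteq> f p" for p
    unfolding \<Lambda> using legendre_isotropic_plane[OF f, of p] sf
    by (intro span_minimal) (auto simp: isotropic_plane_def)
  have s0: "s p \<noteq> 0" for p using ss1[of p] span1[of p] span_0[of "{\<sigma>1 p}"] by auto
  have s\<Lambda>: "s p \<in> \<Lambda> p" for p unfolding \<Lambda> by (intro span_base) simp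
  \<comment> \<open>A degenerate direction of \<open>s\<close> would make it a third curvature sphere.\<close>
  have inj: "X = 0" if "mderiv A s p X \<in> f p" for p X
  proof (rule ccontr)
    assume X: "X \<noteq> 0"
    have "local_section A f p s"
      unfolding local_section_def section_on_def using s sf by blast
    then have "curvature_sphere A f p (span {s p})"
      by (rule curvature_sphere_span[OF atlas f _ s0 X that])
    then have "span {s p} = s1 p \<or> span {s p} = s2 p" using cs[of p] by blast
    then show False using ss1[of p] ss2[of p] span_base[of "s p" "{s p}"] by auto
  qed
  \<comment> \<open>Both potentials are real, so the real part of the complex gauge parameter relates them.\<close>
  obtain \<tau>c where \<tau>c: "smooth_map A UNIV \<tau>c" "\<And>p. \<tau>c p \<in> complexify (wedge_space (f p) (f p))"
    and \<tau>c_eq: "\<And>p X. cembed (\<eta>p p X) = cembed (\<eta> p X) - mderiv A \<tau>c p X"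
    using assms(5) unfolding christoffel_dual_lifts_def in_gauge_orbit_def section_on_def assms(9)[symmetric]
    by blast
  define \<tau> where "\<tau> p = fst (\<tau>c p)" for p
  have \<tau>: "smooth_map A UNIV \<tau>" "\<And>p. \<tau> p \<in> wedge_space (f p) (f p)"
    using smooth_map_linear[OF atlas bounded_linear_fst open_UNIV \<tau>c(1)] \<tau>c(2)
    by (auto simp: \<tau>_def[abs_def] complexify_def mem_Times_iff)
  have eq: "\<eta>p p X = \<eta> p X - mderiv A \<tau> p X" for p X
    using arg_cong[OF \<tau>c_eq[of p X], of fst] mderiv_linear[OF atlas bounded_linear_fst \<tau>c(1), of p X]
    by (simp add: cembed_def \<tau>_def[abs_def])
  have der: "derived A \<Lambda> p \<subseteq> perp (f p)" for p
    using derived_mono[of \<Lambda> f A p] \<Lambda>f f unfolding legendre_map_def by blast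
  have \<eta>p: "\<eta>p p X \<in> wedge_space (f p) (perp (f p))" for p X
    using iso(2) wedge_space_mono[OF \<Lambda>f der] by blast
  have \<eta>pk: "\<eta>p p X k = 0" for p X
  proof (rule wedge_space_kills[OF iso(2)])
    have "k \<in> perp W" if "W \<subseteq> perp {k}" for W
      using that lform_commute[of k] by (fastforce simp: perp_def)
    then show "k \<in> perp (\<Lambda> p)" "k \<in> perp (derived A \<Lambda> p)"
      using iso(1) derived_subset_perp[OF atlas iso(1)] by auto
  qed
  have sk: "lform (s p) k = 0" for p using iso(1) s\<Lambda> by (auto simp: perp_def)
  note ctx = atlas f \<eta> \<eta>p \<tau> eq \<Lambda>f k \<eta>pk assms(11,12)
  show ?thesis
  proof (intro conjI allI impI)
    fix F assume "calapso_transform A U f \<eta> t F"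
    then show "\<exists>g L. orthogonal42 g \<and> isothermic_calapso_transform A U k \<Lambda> \<eta>p t L \<and>
        legendre_lift A U L (\<lambda>p. blinfun_apply g ` F p)"
      by (rule calapso_transform_is_legendre_lift[OF ctx])
  next
    fix L G
    assume "isothermic_calapso_transform A U k \<Lambda> \<eta>p t L \<and> legendre_lift A U L G"
    then show "\<exists>g F. orthogonal42 g \<and> calapso_transform A U f \<eta> t F \<and>
        (\<forall>p\<in>U. G p = blinfun_apply g ` F p)"
      by (elim conjE) (rule legendre_lift_is_calapso_transform[OF ctx s s\<Lambda> s0 sk inj])
  qed
qed

end
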